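(* Let $\Omega$ be an exterior domain as in the context. Let $\mu\in\mathbb{R}$, $\mu\ne0$, and $$\bar{\boldsymbol u}_{0,\mu,0}=\frac{\mu}{2\pi}\frac{\boldsymbol e_\theta}{r}.$$ Then for any $\delta>0$ there exists $\boldsymbol v\in H^1_{0,\sigma}(\Omega)$, $\boldsymbol v\neq\boldsymbol 0$, such that $$\big(\boldsymbol v\cdot\nabla\boldsymbol v,\bar{\boldsymbol u}_{0,\mu,0}\big)\ge\delta\,\|\nabla\boldsymbol v\|_2^2 .$$
   Context: Domain: $\Omega=\mathbb{R}^2\setminus\bar B$, where $B$ is a bounded simply connected Lipschitz domain with $\boldsymbol 0\in B$. $(r,\theta)$ are polar coordinates centered at the origin and $\boldsymbol e_\theta$ is the unit angular vector. $H^1_{0,\sigma}(\Omega)$ is the completion, in the norm of $H^1(\Omega)$, of the space $C^\infty_{0,\sigma}(\Omega)$ of smooth divergence-free vector fields with compact support in $\Omega$. $(\cdot,\cdot)$ is the $L^2(\Omega)$ pairing, so $(\boldsymbol v\cdot\nabla\boldsymbol v,\bar{\boldsymbol u})=\int_\Omega\sum_{i,j}v_i(\partial_iv_j)\bar u_j$, and $\|\cdot\|_2$ is the $L^2(\Omega)$ norm. *)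

theory Defs
  imports "HOL-Analysis.Analysis"
begin

subsection \<open>Smooth functions\<close>

definition partial :: "'n::finite \<Rightarrow> (real ^ 'n \<Rightarrow> 'b::real_normed_vector) \<Rightarrow> real ^ 'n \<Rightarrow> 'b" where
  "partial i f x = frechet_derivative f (at x) (axis i 1)"

text \<open>The matrix with entries \<open>grad v x $ i $ j = \<partial>\<^sub>i v\<^sub>j (x)\<close>; its norm is the Frobenius norm.\<close>

definition grad :: "(real ^ 'n::finite \<Rightarrow> real ^ 'n) \<Rightarrow> real ^ 'n \<Rightarrow> real ^ 'n ^ 'n" where
  "grad v x = (\<chi> i. partial i v x)"

definition divergence :: "(real ^ 'n::finite \<Rightarrow> real ^ 'n) \<Rightarrow> real ^ 'n \<Rightarrow> real" where
  "divergence v x = (\<Sum>i\<in>UNIV. partial i v x $ i)"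

text \<open>\<open>C_k k f\<close>: \<open>f\<close> is of class \<open>C\<^sup>k\<close> on the whole space.\<close>

primrec C_k :: "nat \<Rightarrow> (real ^ 'n::finite \<Rightarrow> 'b::real_normed_vector) \<Rightarrow> bool" where
  "C_k 0 f \<longleftrightarrow> continuous_on UNIV f"
| "C_k (Suc k) f \<longleftrightarrow> (\<forall>x. f differentiable (at x)) \<and> (\<forall>i. C_k k (partial i f))"

text \<open>\<open>C\<^sup>\<infinity>\<close> functions with compact support in \<open>\<Omega>\<close>, extended by zero to the whole space.\<close>

definition test_functions :: "(real ^ 'n::finite) set \<Rightarrow> (real ^ 'n \<Rightarrow> 'b::real_normed_vector) set" where
  "test_functions \<Omega> =
     {\<phi>. (\<forall>k. C_k k \<phi>) \<and> compact (closure {x. \<phi> x \<noteq> 0}) \<and> closure {x. \<phi> x \<noteq> 0} \<subseteq> \<Omega>}"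

definition solenoidal_test_fields :: "(real ^ 'n::finite) set \<Rightarrow> (real ^ 'n \<Rightarrow> real ^ 'n) set" where
  "solenoidal_test_fields \<Omega> = {\<phi> \<in> test_functions \<Omega>. \<forall>x. divergence \<phi> x = 0}"


subsection \<open>The spaces \<open>L\<^sup>2\<close>, \<open>H\<^sup>1\<close> and \<open>H\<^sup>1\<^sub>0\<^sub>,\<^sub>\<sigma>\<close>\<close>

text \<open>Elements of these spaces are represented by functions on the whole space whose values outside
  \<open>\<Omega>\<close> are irrelevant and which are identified when they agree almost everywhere in \<open>\<Omega>\<close>.\<close>

definition L2_space :: "(real ^ 'n::finite) set \<Rightarrow> (real ^ 'n \<Rightarrow> 'b::euclidean_space) set" where
  "L2_space \<Omega> = {f. set_borel_measurable lebesgue \<Omega> f \<and>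
                     set_integrable lebesgue \<Omega> (\<lambda>x. (norm (f x))\<^sup>2)}"

definition L2_inner ::
    "(real ^ 'n::finite) set \<Rightarrow> (real ^ 'n \<Rightarrow> 'b::euclidean_space) \<Rightarrow> (real ^ 'n \<Rightarrow> 'b) \<Rightarrow> real" where
  "L2_inner \<Omega> f g = (LINT x:\<Omega>|lebesgue. f x \<bullet> g x)"

definition L2_norm :: "(real ^ 'n::finite) set \<Rightarrow> (real ^ 'n \<Rightarrow> 'b::euclidean_space) \<Rightarrow> real" where
  "L2_norm \<Omega> f = sqrt (LINT x:\<Omega>|lebesgue. (norm (f x))\<^sup>2)"

text \<open>\<open>v\<close> lies in \<open>H\<^sup>1(\<Omega>)\<close> and \<open>G\<close> is (a representative of) its distributional gradient, in the
  index convention of \<^const>\<open>grad\<close>.\<close>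

definition has_H1_gradient ::
    "(real ^ 'n::finite) set \<Rightarrow> (real ^ 'n \<Rightarrow> real ^ 'n) \<Rightarrow> (real ^ 'n \<Rightarrow> real ^ 'n ^ 'n) \<Rightarrow> bool" where
  "has_H1_gradient \<Omega> v G \<longleftrightarrow> v \<in> L2_space \<Omega> \<and> G \<in> L2_space \<Omega> \<and>
     (\<forall>\<phi> \<in> test_functions \<Omega>. \<forall>i j.
        (LINT x:\<Omega>|lebesgue. v x $ j * partial i \<phi> x) =
        - (LINT x:\<Omega>|lebesgue. G x $ i $ j * \<phi> x))"

text \<open>The \<open>H\<^sup>1\<close> norm of a field \<open>v\<close> with gradient \<open>G\<close>.\<close>

definition H1_norm ::
    "(real ^ 'n::finite) set \<Rightarrow> (real ^ 'n \<Rightarrow> real ^ 'n) \<Rightarrow> (real ^ 'n \<Rightarrow> real ^ 'n ^ 'n) \<Rightarrow> real" where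
  "H1_norm \<Omega> v G = sqrt ((L2_norm \<Omega> v)\<^sup>2 + (L2_norm \<Omega> G)\<^sup>2)"

text \<open>As \<open>H\<^sup>1(\<Omega>)\<close> is complete, the completion of the solenoidal test fields in the \<open>H\<^sup>1\<close> norm is
  their closure in \<open>H\<^sup>1(\<Omega>)\<close>.\<close>

definition H1_0_sigma :: "(real ^ 'n::finite) set \<Rightarrow> (real ^ 'n \<Rightarrow> real ^ 'n) set" where
  "H1_0_sigma \<Omega> =
     {v. \<exists>G. has_H1_gradient \<Omega> v G \<and>
          (\<exists>\<phi>. (\<forall>n. \<phi> n \<in> solenoidal_test_fields \<Omega>) \<and>
               (\<lambda>n::nat. H1_norm \<Omega> (\<lambda>x. \<phi> n x - v x) (\<lambda>x. grad (\<phi> n) x - G x))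
                 \<longlonglongrightarrow> 0)}"


subsection \<open>Planar domains and the circular flow\<close>

text \<open>A domain whose boundary is locally, in suitable orthonormal coordinates, the graph of a
  Lipschitz function with the domain lying on one side of it.\<close>

definition lipschitz_domain :: "(real ^ 2) set \<Rightarrow> bool" where
  "lipschitz_domain B \<longleftrightarrow> open B \<and> connected B \<and> B \<noteq> {} \<and>
     (\<forall>p \<in> frontier B. \<exists>r > 0. \<exists>(T :: real ^ 2 \<Rightarrow> real ^ 2) (g :: real \<Rightarrow> real) L. orthogonal_transformation T \<and> L-lipschitz_on UNIV g \<and>
        B \<inter> ball p r = {x \<in> ball p r. g (T (x - p) $ 1) < T (x - p) $ 2})"

text \<open>For \<open>x = r (cos \<theta>, sin \<theta>)\<close> with \<open>r > 0\<close> this is \<open>(- sin \<theta>, cos \<theta>)\<close>.\<close>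

definition e_theta :: "real ^ 2 \<Rightarrow> real ^ 2" where
  "e_theta x = vector [- (x $ 2) / norm x, x $ 1 / norm x]"

definition circular_flow :: "real \<Rightarrow> real ^ 2 \<Rightarrow> real ^ 2" where
  "circular_flow \<mu> x = (\<mu> / (2 * pi)) *\<^sub>R ((1 / norm x) *\<^sub>R e_theta x)"

text \<open>The field \<open>v \<cdot> \<nabla>v\<close>, given \<open>v\<close> and its gradient \<open>G\<close>.\<close>

definition convection ::
    "(real ^ 'n::finite \<Rightarrow> real ^ 'n) \<Rightarrow> (real ^ 'n \<Rightarrow> real ^ 'n ^ 'n) \<Rightarrow> real ^ 'n \<Rightarrow> real ^ 'n" where
  "convection v G x = (\<chi> j. \<Sum>i\<in>UNIV. v x $ i * G x $ i $ j)"

end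

theory Submission
  imports Defs
begin

text \<open>
  In the plane Hardy's inequality fails logarithmically, and only for fields that are nearly constant.
  Take a field that is almost a constant vector at each scale, whose direction turns slowly with
  \<open>ln |x|\<close>: its stream function is \<open>x\<^sub>1 a + x\<^sub>2 b\<close>, where \<open>(a, b)\<close> is the point
  \<open>h(s) (cos s, \<plusminus> sin s)\<close> at \<open>s = 2 k ln |x|\<close> and \<open>h\<close> is a bump function supported in \<open>[1, 4]\<close>.
  Averaged over rotations by \<open>90\<close> degrees, the integrand of the convective term is
  \<open>|\<mu>| k h\<^sup>2 / (\<pi> |x|\<^sup>2)\<close> up to \<open>O(k\<^sup>2 / |x|\<^sup>2)\<close>, while \<open>|\<nabla>v|\<^sup>2 = O(k\<^sup>2 / |x|\<^sup>2)\<close>.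
  The weight \<open>1 / |x|\<^sup>2\<close> has the same integral over each ring \<open>j \<le> s < j + 1\<close>, so the ratio of the
  two sides is of order \<open>1 / k\<close>. For small \<open>k\<close> the support of the field avoids the obstacle.
\<close>

subsection \<open>Smooth functions of one variable\<close>

definition flat :: "real poly \<Rightarrow> real \<Rightarrow> real" where
  "flat p t = (if t > 0 then poly p (inverse t) * exp (- inverse t) else 0)"

text \<open>Substituting y = 1/t on the right turns the claim into the decay of a polynomial times
  exp(-y) at infinity; on the left the function is zero.\<close>

lemma flat_tendsto_0: "(flat p \<longlongrightarrow> 0) (at 0)"
proof -
  have "((\<lambda>y::real. poly p y * exp (- y)) \<longlongrightarrow> 0) at_top"
  proof (induction p)
    case (pCons a p)
    have monom: "((\<lambda>y::real. y ^ n * exp (- y)) \<longlongrightarrow> 0) at_top" for n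
      using tendsto_power_div_exp_0[of n] by (simp add: exp_minus divide_inverse)
    have "((\<lambda>y::real. poly q y * exp (- y)) \<longlongrightarrow> 0) at_top" for q :: "real poly"
      unfolding poly_altdef sum_distrib_right
      by (rule tendsto_null_sum) (use tendsto_mult_right_zero[OF monom] in \<open>auto simp: mult.assoc\<close>)
    then show ?case .
  qed simp
  then have "((\<lambda>t. poly p (inverse t) * exp (- inverse t)) \<longlongrightarrow> 0) (at_right 0)"
    by (rule filterlim_compose) (rule filterlim_inverse_at_top_right)
  then have "(flat p \<longlongrightarrow> 0) (at_right 0)"
    by (rule Lim_transform_eventually)
       (auto simp: flat_def eventually_at_right_field intro!: exI[of _ 1])
  moreover have "(flat p \<longlongrightarrow> 0) (at_left 0)"
    by (rule Lim_transform_eventually[of "\<lambda>_. 0"])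
       (auto simp: flat_def eventually_at_left_field intro!: exI[of _ "-1"])
  ultimately show ?thesis
    by (rule filterlim_split_at_real[rotated])
qed

text \<open>With s = 1/t one has d/dt = - s^2 d/ds, and applying this to p(s) exp(-s) gives s^2 (p -
  p')(s) exp(-s); \<open>[:0, 0, 1:]\<close> is the polynomial s^2.\<close>

lemma flat_has_derivative:
  "(flat p has_real_derivative flat ([:0, 0, 1:] * (p - pderiv p)) t) (at t)"
proof -
  consider "t > 0" | "t < 0" | "t = 0" by linarith
  then show ?thesis
  proof cases
    case 1
    have "((\<lambda>t. poly p (inverse t) * exp (- inverse t)) has_real_derivative
        flat ([:0, 0, 1:] * (p - pderiv p)) t) (at t)"
      using 1 by (auto intro!: derivative_eq_intros poly_DERIV[THEN DERIV_chain2]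
          simp: flat_def field_simps power2_eq_square)
    then show ?thesis
      by (rule has_field_derivative_transform_within_open[where S = "{0<..}"])
         (use 1 in \<open>auto simp: flat_def\<close>)
  next
    case 2
    have "((\<lambda>_. 0) has_real_derivative flat ([:0, 0, 1:] * (p - pderiv p)) t) (at t)"
      using 2 by (simp add: flat_def)
    then show ?thesis
      by (rule has_field_derivative_transform_within_open[where S = "{..<0}"])
         (use 2 in \<open>auto simp: flat_def\<close>)
  next
    case 3
    \<comment> \<open>At the origin the difference quotient divides by h, that is, multiplies the
      polynomial by its variable 1/h, so it stays in the family and tends to zero.\<close>
    have "(\<lambda>h. (flat p (0 + h) - flat p 0) / h) = flat ([:0, 1:] * p)"
      by (auto simp: flat_def fun_eq_iff field_simps)
    then show ?thesis
      using 3 flat_tendsto_0[of "[:0, 1:] * p"] by (simp add: DERIV_def flat_def)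
  qed
qed

text \<open>An explicit class closed under differentiation, so that membership yields derivatives of
  every order. The affine arguments supply the cosine as a shifted sine, reflected cutoffs and the
  slow rescaling of the profiles.\<close>

inductive elem_smooth :: "(real \<Rightarrow> real) \<Rightarrow> bool" where
  const: "elem_smooth (\<lambda>_. c)"
| exp: "elem_smooth (\<lambda>t. exp (c * t + d))"
| sin: "elem_smooth (\<lambda>t. sin (c * t + d))"
| flat: "elem_smooth (\<lambda>t. flat p (c * t + d))"
| add: "elem_smooth f \<Longrightarrow> elem_smooth g \<Longrightarrow> elem_smooth (\<lambda>t. f t + g t)"
| mult: "elem_smooth f \<Longrightarrow> elem_smooth g \<Longrightarrow> elem_smooth (\<lambda>t. f t * g t)"

lemma elem_smooth_affine: "elem_smooth f \<Longrightarrow> elem_smooth (\<lambda>t. f (c * t + d))"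
proof (induction rule: elem_smooth.induct)
  case (exp c' d')
  show ?case using elem_smooth.exp[of "c' * c" "c' * d + d'"] by (simp add: algebra_simps)
next
  case (sin c' d')
  show ?case using elem_smooth.sin[of "c' * c" "c' * d + d'"] by (simp add: algebra_simps)
next
  case (flat p c' d')
  show ?case using elem_smooth.flat[of p "c' * c" "c' * d + d'"] by (simp add: algebra_simps)
qed (auto intro: elem_smooth.intros)

lemma elem_smooth_cmult: "elem_smooth f \<Longrightarrow> elem_smooth (\<lambda>t. c * f t)"
  by (intro elem_smooth.intros)

lemma elem_smooth_diff:
  assumes "elem_smooth f" "elem_smooth g"
  shows "elem_smooth (\<lambda>t. f t - g t)"
  using elem_smooth.add[OF assms(1) elem_smooth_cmult[OF assms(2), of "-1"]] by simp

lemma elem_smooth_derivative: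
  "elem_smooth f \<Longrightarrow> \<exists>f'. elem_smooth f' \<and> (\<forall>t. (f has_real_derivative f' t) (at t))"
proof (induction rule: elem_smooth.induct)
  case (const c)
  then show ?case by (intro exI[of _ "\<lambda>_. 0"]) (auto intro: elem_smooth.intros)
next
  case (exp c d)
  show ?case
    by (rule exI[of _ "\<lambda>t. c * exp (c * t + d)"])
       (auto intro!: elem_smooth.intros derivative_eq_intros)
next
  case (sin c d)
  have "elem_smooth (\<lambda>t. c * sin (c * t + (d + pi / 2)))"
    by (intro elem_smooth.intros)
  then show ?case
    by (intro exI[of _ "\<lambda>t. c * sin (c * t + (d + pi / 2))"])
       (auto intro!: derivative_eq_intros simp: sin_add[of _ "pi / 2"] add.assoc[symmetric])
next
  case (flat p c d)
  let ?q = "[:0, 0, 1:] * (p - pderiv p)"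
  have "((\<lambda>t. flat p (c * t + d)) has_real_derivative flat ?q (c * t + d) * c) (at t)" for t
    by (rule DERIV_chain2[OF flat_has_derivative]) (auto intro!: derivative_eq_intros)
  then show ?case
    using elem_smooth.mult[OF elem_smooth.flat elem_smooth.const] by blast
next
  case (add f g)
  then obtain f' g' where "elem_smooth f'" "\<forall>t. (f has_real_derivative f' t) (at t)"
    "elem_smooth g'" "\<forall>t. (g has_real_derivative g' t) (at t)" by blast
  then show ?case
    by (intro exI[of _ "\<lambda>t. f' t + g' t"]) (auto intro!: elem_smooth.intros derivative_intros)
next
  case (mult f g)
  then obtain f' g' where "elem_smooth f'" "\<forall>t. (f has_real_derivative f' t) (at t)"
    "elem_smooth g'" "\<forall>t. (g has_real_derivative g' t) (at t)" by blast
  then show ?case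
    by (intro exI[of _ "\<lambda>t. f t * g' t + f' t * g t"])
       (auto intro!: elem_smooth.intros derivative_eq_intros mult)
qed

lemma has_real_derivative_zero:
  assumes "(f has_real_derivative c) (at t)" "open S" "t \<in> S" "\<And>u. u \<in> S \<Longrightarrow> f u = (0::real)"
  shows "c = 0"
proof -
  have "((\<lambda>_. 0) has_real_derivative c) (at t)"
    using assms by (intro has_field_derivative_transform_within_open[OF assms(1-3)]) auto
  then show ?thesis using DERIV_const DERIV_unique by blast
qed

subsection \<open>Smooth functions of several variables\<close>

text \<open>Total differentiability with named coefficients: \<open>C_k\<close> asks for Frechet
  derivatives, and the explicit family \<open>f'\<close> is what later formulas compute
  with.\<close>

definition has_partials :: "(real ^ 'n::finite \<Rightarrow> real) \<Rightarrow> ('n \<Rightarrow> real ^ 'n \<Rightarrow> real) \<Rightarrow> bool" where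
  "has_partials f f' \<longleftrightarrow> (\<forall>x. (f has_derivative (\<lambda>h. \<Sum>i\<in>UNIV. h $ i * f' i x)) (at x))"

lemma has_partials_const: "has_partials (\<lambda>_. c) (\<lambda>i x. 0)"
  by (auto simp: has_partials_def)

lemma has_partials_coord:
  fixes j :: "'n::finite"
  shows "has_partials (\<lambda>x. x $ j) (\<lambda>i x. axis j 1 $ i)"
proof -
  have "(\<lambda>h. \<Sum>i\<in>UNIV. h $ i * axis j 1 $ i) = (\<lambda>h::real^'n. h $ j)"
    by (auto simp: fun_eq_iff axis_def if_distrib cong: if_cong)
  then show ?thesis
    by (auto simp: has_partials_def intro!: bounded_linear_imp_has_derivative bounded_linear_vec_nth)
qed

lemma has_partials_add:
  assumes "has_partials f f'" "has_partials g g'"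
  shows "has_partials (\<lambda>x. f x + g x) (\<lambda>i x. f' i x + g' i x)"
  unfolding has_partials_def
proof
  fix x
  show "((\<lambda>x. f x + g x) has_derivative (\<lambda>h. \<Sum>i\<in>UNIV. h $ i * (f' i x + g' i x))) (at x)"
    by (rule has_derivative_eq_rhs[OF has_derivative_add[OF assms[unfolded has_partials_def, rule_format]]])
       (simp add: fun_eq_iff sum.distrib distrib_left)
qed

lemma has_partials_mult:
  assumes "has_partials f f'" "has_partials g g'"
  shows "has_partials (\<lambda>x. f x * g x) (\<lambda>i x. f x * g' i x + f' i x * g x)"
  unfolding has_partials_def
proof
  fix x
  have "f x * (\<Sum>i\<in>UNIV. h $ i * g' i x) + (\<Sum>i\<in>UNIV. h $ i * f' i x) * g x =
      (\<Sum>i\<in>UNIV. h $ i * (f x * g' i x + f' i x * g x))" for h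
    unfolding sum_distrib_left sum_distrib_right sum.distrib[symmetric]
    by (intro sum.cong) (auto simp: algebra_simps)
  then show "((\<lambda>x. f x * g x) has_derivative
      (\<lambda>h. \<Sum>i\<in>UNIV. h $ i * (f x * g' i x + f' i x * g x))) (at x)"
    using has_derivative_mult[OF assms[unfolded has_partials_def, rule_format], of x] by simp
qed

lemma has_partials_minus: "has_partials f f' \<Longrightarrow> has_partials (\<lambda>x. - f x) (\<lambda>i x. - f' i x)"
  using has_partials_mult[OF has_partials_const[of "-1"]] by fastforce

lemma has_partials_cong:
  assumes "has_partials f f'" "\<And>x. f x = g x" "\<And>i x. f' i x = g' i x"
  shows "has_partials g g'"
proof -
  have "f = g" "f' = g'" using assms by (auto intro!: ext)
  then show ?thesis using assms by simp
qed

lemma partial_unique: "has_partials f f' \<Longrightarrow> partial i f = f' i"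
proof
  fix x assume "has_partials f f'"
  then have "frechet_derivative f (at x) = (\<lambda>h. \<Sum>i\<in>UNIV. h $ i * f' i x)"
    unfolding has_partials_def by (intro frechet_derivative_at[symmetric]) blast
  then show "partial i f x = f' i x"
    by (simp add: partial_def axis_def if_distrib if_distribR cong: if_cong)
qed

text \<open>Since \<open>ln 0 = 0\<close>, the vanishing of the profile \<open>g\<close> on \<open>{..<1}\<close> also makes \<open>g (ln (x \<bullet> x))\<close>
  smooth at the origin.\<close>

lemma has_partials_radial:
  assumes g: "\<And>t. (g has_real_derivative g' t) (at t)" and "\<And>t. t < 1 \<Longrightarrow> g t = 0"
  shows "has_partials (\<lambda>x::real^'n::finite. g (ln (x \<bullet> x)))
           (\<lambda>i x. 2 * x $ i * (g' (ln (x \<bullet> x)) * exp (- ln (x \<bullet> x))))"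
proof -
  have "((\<lambda>x. g (ln (x \<bullet> x))) has_derivative
      (\<lambda>h. \<Sum>i\<in>UNIV. h $ i * (2 * x $ i * (g' (ln (x \<bullet> x)) * exp (- ln (x \<bullet> x)))))) (at x)"
    for x :: "real^'n"
  proof (cases "x = 0")
    case True
    have zero: "g (ln (y \<bullet> y)) = 0" if "y \<in> ball 0 1" for y :: "real^'n"
    proof -
      have "norm y ^ 2 \<le> 1" using that by (auto simp: power_le_one)
      then have "ln (y \<bullet> y) \<le> 0"
        using ln_le_zero_iff[of "y \<bullet> y"] by (cases "y = 0") (auto simp: power2_norm_eq_inner)
      then show ?thesis using assms(2) by simp
    qed
    have "((\<lambda>x. g (ln (x \<bullet> x))) has_derivative (\<lambda>h. 0)) (at x)"
      by (rule has_derivative_transform_within_open[OF has_derivative_const[of 0] open_ball[of 0 1]])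
         (use True in \<open>auto simp: zero simp del: mem_ball\<close>)
    then show ?thesis using True by simp
  next
    case False
    then have pos: "x \<bullet> x > 0" by simp
    have "((\<lambda>x. ln (x \<bullet> x)) has_derivative (\<lambda>h. 2 * (x \<bullet> h) / (x \<bullet> x))) (at x)"
      by (rule has_derivative_eq_rhs[OF has_derivative_ln[OF pos has_derivative_inner[OF
            has_derivative_ident has_derivative_ident]]])
         (simp add: fun_eq_iff inner_commute divide_inverse)
    from has_derivative_compose[OF this g[unfolded has_field_derivative_def]]
    have "((\<lambda>x. g (ln (x \<bullet> x))) has_derivative
        (\<lambda>h. g' (ln (x \<bullet> x)) * (2 * (x \<bullet> h) / (x \<bullet> x)))) (at x)" .
    \<comment> \<open>Here \<open>exp (- ln (x \<bullet> x))\<close> is 1/|x|^2. The exponential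
      form makes each partial derivative a coordinate times a function of
      \<open>ln (x \<bullet> x)\<close>, ready for further differentiation.\<close>
    moreover have "(\<Sum>i\<in>UNIV. h $ i * (2 * x $ i * (g' (ln (x \<bullet> x)) * exp (- ln (x \<bullet> x))))) =
        g' (ln (x \<bullet> x)) * (2 * (x \<bullet> h) / (x \<bullet> x))" for h
    proof -
      have "(\<Sum>i\<in>UNIV. h $ i * (2 * x $ i * (g' (ln (x \<bullet> x)) * exp (- ln (x \<bullet> x))))) =
          (\<Sum>i\<in>UNIV. 2 * g' (ln (x \<bullet> x)) * exp (- ln (x \<bullet> x)) * (x $ i * h $ i))"
        by (intro sum.cong) auto
      also have "\<dots> = 2 * g' (ln (x \<bullet> x)) * exp (- ln (x \<bullet> x)) * (x \<bullet> h)"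
        unfolding sum_distrib_left[symmetric] by (simp add: inner_vec_def)
      finally show ?thesis
        using pos by (simp add: exp_minus divide_inverse)
    qed
    ultimately show ?thesis by simp
  qed
  then show ?thesis by (auto simp: has_partials_def)
qed

text \<open>The counterpart of \<open>elem_smooth\<close> in several variables, closed under partial
  derivatives. The vanishing condition on radial profiles removes the singularity of the logarithm
  at the origin.\<close>

inductive elem_field :: "(real ^ 'n::finite \<Rightarrow> real) \<Rightarrow> bool" where
  const: "elem_field (\<lambda>_. c)"
| coord: "elem_field (\<lambda>x. x $ i)"
| radial: "elem_smooth g \<Longrightarrow> (\<And>t. t < 1 \<Longrightarrow> g t = 0) \<Longrightarrow> elem_field (\<lambda>x. g (ln (x \<bullet> x)))"
| add: "elem_field f \<Longrightarrow> elem_field g \<Longrightarrow> elem_field (\<lambda>x. f x + g x)"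
| mult: "elem_field f \<Longrightarrow> elem_field g \<Longrightarrow> elem_field (\<lambda>x. f x * g x)"

lemma elem_field_minus: "elem_field f \<Longrightarrow> elem_field (\<lambda>x. - f x)"
  using elem_field.mult[OF elem_field.const[of "-1"], of f] by simp

lemma elem_field_partials:
  "elem_field f \<Longrightarrow> \<exists>f'. has_partials f f' \<and> (\<forall>i. elem_field (f' i))"
proof (induction rule: elem_field.induct)
  case (radial g)
  then obtain g' where g': "elem_smooth g'" "\<And>t. (g has_real_derivative g' t) (at t)"
    using elem_smooth_derivative by blast
  \<comment> \<open>Vanishing below 1 is inherited by the derivative, so the new radial factor again
    meets the side condition of \<open>radial\<close>.\<close>
  have g'0: "g' t = 0" if "t < 1" for t
    using has_real_derivative_zero[OF g'(2)[of t], of "{..<1}"] that radial by auto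
  have "elem_smooth (\<lambda>t. g' t * exp (- t))"
    using g'(1) elem_smooth.exp[of "-1" 0] by (auto intro: elem_smooth.mult)
  from elem_field.radial[OF this] g'0
  have "elem_field (\<lambda>x::real^'n. g' (ln (x \<bullet> x)) * exp (- ln (x \<bullet> x)))" by simp
  then have "elem_field (\<lambda>x::real^'n. 2 * x $ i * (g' (ln (x \<bullet> x)) * exp (- ln (x \<bullet> x))))" for i
    by (rule elem_field.mult[OF elem_field.mult[OF elem_field.const elem_field.coord]])
  then show ?case
    using has_partials_radial[OF g'(2) radial(2)]
    by (intro exI[of _ "\<lambda>i x. 2 * x $ i * (g' (ln (x \<bullet> x)) * exp (- ln (x \<bullet> x)))"] conjI)
       auto
next
  case (add f g)
  then obtain f' g' where "has_partials f f'" "\<forall>i. elem_field (f' i)"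
    "has_partials g g'" "\<forall>i. elem_field (g' i)" by blast
  then show ?case
    by (intro exI[of _ "\<lambda>i x. f' i x + g' i x"]) (simp add: has_partials_add elem_field.add)
next
  case (mult f g)
  then obtain f' g' where "has_partials f f'" "\<forall>i. elem_field (f' i)"
    "has_partials g g'" "\<forall>i. elem_field (g' i)" by blast
  with mult.hyps show ?case
    by (intro exI[of _ "\<lambda>i x. f x * g' i x + f' i x * g x"])
       (simp add: has_partials_mult elem_field.add elem_field.mult)
qed (blast intro: has_partials_const has_partials_coord elem_field.const)+

lemma elem_field_continuous: "elem_field f \<Longrightarrow> continuous_on UNIV f"
  using elem_field_partials[of f]
  by (auto simp: has_partials_def intro: has_derivative_continuous_on)

lemma vec_has_derivative:
  fixes f :: "real ^ 'n::finite \<Rightarrow> real ^ 'm::finite"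
  assumes "\<And>j. has_partials (\<lambda>x. f x $ j) (f' j)"
  shows "(f has_derivative (\<lambda>h. \<chi> j. \<Sum>i\<in>UNIV. h $ i * f' j i x)) (at x)"
  using assms unfolding has_partials_def
  by (subst has_derivative_componentwise_within)
     (auto simp: Basis_vec_def inner_axis)

lemma partial_vec:
  fixes f :: "real ^ 'n::finite \<Rightarrow> real ^ 'm::finite"
  assumes "\<And>j. has_partials (\<lambda>x. f x $ j) (f' j)"
  shows "partial i f x = (\<chi> j. f' j i x)"
  using frechet_derivative_at[OF vec_has_derivative[of f f' x, OF assms], symmetric]
  by (simp add: partial_def axis_def if_distrib if_distribR cong: if_cong)

text \<open>Induction on the order with the field arbitrary: every component of a partial derivative
  belongs to \<open>elem_field\<close> again.\<close>

lemma elem_field_C_k: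
  fixes f :: "real ^ 'n::finite \<Rightarrow> real ^ 'm::finite"
  shows "(\<And>j. elem_field (\<lambda>x. f x $ j)) \<Longrightarrow> C_k k f"
proof (induction k arbitrary: f)
  case 0
  have "continuous_on UNIV (\<lambda>x. \<chi> j. f x $ j)"
    by (intro continuous_on_vec_lambda elem_field_continuous 0)
  then show ?case by simp
next
  case (Suc k)
  obtain f' where f': "\<And>j. has_partials (\<lambda>x. f x $ j) (f' j)" "\<And>i j. elem_field (f' j i)"
    using choice[of "\<lambda>j g. has_partials (\<lambda>x. f x $ j) g \<and> (\<forall>i. elem_field (g i))"]
      elem_field_partials[OF Suc.prems] by blast
  have "f differentiable (at x)" for x
    using vec_has_derivative[OF f'(1)] by (auto simp: differentiable_def)
  moreover have "C_k k (partial i f)" for i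
    using f'(2) by (intro Suc.IH) (simp add: partial_vec[of f f', OF f'(1)])
  ultimately show ?case by simp
qed

subsection \<open>Integration by parts\<close>

lemma integrable_compact_support:
  fixes f :: "'a::euclidean_space \<Rightarrow> 'b::{banach, second_countable_topology}"
  assumes "continuous_on UNIV f" "compact K" "\<And>x. x \<notin> K \<Longrightarrow> f x = 0"
  shows "integrable lborel f"
proof -
  have "integrable lborel (\<lambda>x. indicator K x *\<^sub>R f x)"
    using assms by (intro borel_integrable_compact) (auto intro: continuous_on_subset)
  moreover have "(\<lambda>x. indicator K x *\<^sub>R f x) = f"
    using assms(3) by (auto simp: indicator_def fun_eq_iff)
  ultimately show ?thesis by simp
qed

lemma bounded_compact_support:
  fixes f :: "'a::euclidean_space \<Rightarrow> real"
  assumes "continuous_on UNIV f" "compact K" "\<And>x. x \<notin> K \<Longrightarrow> f x = 0"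
  obtains M where "\<And>x. \<bar>f x\<bar> \<le> M" "0 \<le> M"
proof -
  have "compact (f ` K)"
    using assms by (intro compact_continuous_image) (auto intro: continuous_on_subset)
  then obtain b where "b > 0" "\<forall>y\<in>f ` K. norm y \<le> b"
    using compact_imp_bounded bounded_pos by blast
  with assms(3) that[of b] show ?thesis
    by (metis abs_zero image_eqI less_eq_real_def real_norm_def)
qed

lemma partial_outside:
  fixes f :: "real ^ 'n::finite \<Rightarrow> 'b::real_normed_vector"
  assumes "closed K" "\<And>x. x \<notin> K \<Longrightarrow> f x = 0" "x \<notin> K"
  shows "partial i f x = 0"
proof -
  have "(f has_derivative (\<lambda>h. 0)) (at x)"
    by (rule has_derivative_transform_within_open[OF has_derivative_const[of 0], where s = "- K"])
       (use assms in auto)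
  from frechet_derivative_at[OF this] show ?thesis
    by (metis partial_def)
qed

text \<open>Restriction to a coordinate line makes the mean value theorem and difference quotients
  of one variable available.\<close>

lemma differentiable_line:
  fixes f :: "real ^ 'n::finite \<Rightarrow> real"
  assumes "\<And>x. f differentiable (at x)"
  shows "((\<lambda>t. f (x + t *\<^sub>R axis i 1)) has_real_derivative partial i f (x + t *\<^sub>R axis i 1)) (at t)"
proof -
  let ?y = "x + t *\<^sub>R axis i 1"
  have D: "(f has_derivative frechet_derivative f (at ?y)) (at ?y)"
    using assms frechet_derivative_works by blast
  have "((\<lambda>t. x + t *\<^sub>R axis i 1) has_derivative (\<lambda>s. s *\<^sub>R axis i 1)) (at t)"
    by (auto intro!: derivative_eq_intros)
  from has_derivative_compose[OF this D]
  have "((\<lambda>t. f (x + t *\<^sub>R axis i 1)) has_derivative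
      (\<lambda>s. frechet_derivative f (at ?y) (s *\<^sub>R axis i 1))) (at t)" .
  moreover have "frechet_derivative f (at ?y) (s *\<^sub>R axis i 1) = partial i f ?y * s" for s
    using linear_scale[OF has_derivative_linear[OF D]] by (simp add: partial_def)
  ultimately show ?thesis
    by (simp add: has_field_derivative_def)
qed

lemma integral_translation:
  fixes f :: "'a::euclidean_space \<Rightarrow> real"
  assumes "f \<in> borel_measurable borel"
  shows "(LINT x|lborel. f (x + a)) = integral\<^sup>L lborel f"
proof -
  have "integral\<^sup>L lborel f = integral\<^sup>L (distr lborel borel ((+) a)) f"
    by (simp add: lborel_distr_plus)
  also have "\<dots> = (LINT x|lborel. f (x + a))"
    using assms by (subst integral_distr) (auto simp: add.commute)
  finally show ?thesis ..
qed

text \<open>Difference quotients in direction \<open>i\<close> integrate to zero by translation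
  invariance, and dominated convergence passes this on to the derivative.\<close>

lemma integral_partial_eq_0:
  fixes f :: "real ^ 'n::finite \<Rightarrow> real"
  assumes diff: "\<And>x. f differentiable (at x)" and cont: "continuous_on UNIV (partial i f)"
    and K: "compact K" "\<And>x. x \<notin> K \<Longrightarrow> f x = 0"
  shows "integral\<^sup>L lborel (partial i f) = 0"
proof -
  define e :: "real ^ 'n" where "e = axis i 1"
  have norm_e: "norm e = 1" by (simp add: e_def norm_axis_1)
  define h where "h n = inverse (real (Suc n))" for n
  have h: "0 < h n" "h n \<le> 1" for n by (auto simp: h_def inverse_le_1_iff)
  define d where "d n x = (f (x + h n *\<^sub>R e) - f x) / h n" for n x
  have contf: "continuous_on UNIV f"
    using diff by (intro continuous_at_imp_continuous_on) (auto intro: differentiable_imp_continuous_within)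
  have [measurable]: "f \<in> borel_measurable borel" "partial i f \<in> borel_measurable borel"
    using contf cont by (auto intro: borel_measurable_continuous_onI)
  obtain M where M: "\<And>x. \<bar>partial i f x\<bar> \<le> M" "0 \<le> M"
    using bounded_compact_support[OF cont K(1) partial_outside[OF compact_imp_closed[OF K(1)] K(2)]] by blast
  obtain r where r: "\<And>x. x \<in> K \<Longrightarrow> norm x \<le> r"
    using compact_imp_bounded[OF K(1)] bounded_iff by metis
  \<comment> \<open>The mean value theorem bounds the quotient by \<open>M\<close>. As the steps
    \<open>h n\<close> are at most 1 and \<open>K\<close> lies within radius \<open>r\<close>, all
    quotients vanish outside radius \<open>r + 1\<close>.\<close>
  have bound: "norm (d n x) \<le> M * indicator (cball 0 (r + 1)) x" for n x
  proof (cases "x \<in> cball 0 (r + 1)")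
    case True
    obtain z where "f (x + h n *\<^sub>R e) - f (x + 0 *\<^sub>R e) = (h n - 0) * partial i f (x + z *\<^sub>R e)"
      using MVT2[OF h(1)[of n] differentiable_line[OF diff, of x i]] unfolding e_def by blast
    then have "d n x = partial i f (x + z *\<^sub>R e)"
      using h(1)[of n] by (simp add: d_def)
    then show ?thesis using M True by simp
  next
    case False
    then have "norm x > r + 1" by simp
    moreover have "norm x \<le> norm (x + h n *\<^sub>R e) + h n"
      using norm_triangle_ineq4[of "x + h n *\<^sub>R e" "h n *\<^sub>R e"] h(1)[of n] norm_e by simp
    ultimately have "x + h n *\<^sub>R e \<notin> K" "x \<notin> K"
      using r[of x] r[of "x + h n *\<^sub>R e"] h(2)[of n] by linarith+
    then show ?thesis using K(2) M(2) by (simp add: d_def)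
  qed
  have lim: "(\<lambda>n. d n x) \<longlonglongrightarrow> partial i f x" for x
  proof -
    have "((\<lambda>t. (f (x + (0 + t) *\<^sub>R e) - f (x + 0 *\<^sub>R e)) / t) \<longlongrightarrow> partial i f (x + 0 *\<^sub>R e)) (at 0)"
      using differentiable_line[OF diff, of x i 0] unfolding DERIV_def e_def by simp
    moreover have "filterlim h (at 0) sequentially"
      using h(1) LIMSEQ_inverse_real_of_nat unfolding h_def
      by (auto simp: filterlim_at intro!: always_eventually)
    ultimately have "(\<lambda>n. (f (x + (0 + h n) *\<^sub>R e) - f (x + 0 *\<^sub>R e)) / h n) \<longlonglongrightarrow> partial i f (x + 0 *\<^sub>R e)"
      by (rule filterlim_compose)
    then show ?thesis by (simp add: d_def)
  qed
  have [measurable]: "d n \<in> borel_measurable borel" for n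
    unfolding d_def[abs_def] by measurable
  have "integrable lborel (\<lambda>x::real^'n. M * indicator (cball 0 (r + 1)) x)"
    using emeasure_bounded_finite[OF bounded_cball, of "0::real^'n" "r + 1"]
    by (intro integrable_mult_right) (simp add: integrable_indicator_iff)
  then have "(\<lambda>n. integral\<^sup>L lborel (d n)) \<longlonglongrightarrow> integral\<^sup>L lborel (partial i f)"
    by (intro integral_dominated_convergence[where w = "\<lambda>x. M * indicator (cball 0 (r + 1)) x"])
       (use bound lim in auto)
  moreover have "integral\<^sup>L lborel (d n) = 0" for n
  proof -
    have "compact ((\<lambda>x. x - h n *\<^sub>R e) ` K)"
      using K(1) by (intro compact_continuous_image continuous_intros)
    moreover have "f (x + h n *\<^sub>R e) = 0" if "x \<notin> (\<lambda>x. x - h n *\<^sub>R e) ` K" for x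
    proof (rule K(2))
      show "x + h n *\<^sub>R e \<notin> K"
        using that image_eqI[of x "\<lambda>x. x - h n *\<^sub>R e" "x + h n *\<^sub>R e" K] by auto
    qed
    moreover have "continuous_on UNIV (\<lambda>x. f (x + h n *\<^sub>R e))"
      by (intro continuous_on_compose2[OF contf] continuous_intros) auto
    ultimately have "integrable lborel (\<lambda>x. f (x + h n *\<^sub>R e))"
      by (intro integrable_compact_support) auto
    then show ?thesis
      using integrable_compact_support[OF contf K] integral_translation[of f "h n *\<^sub>R e"]
      unfolding d_def by simp
  qed
  ultimately show ?thesis by (simp add: LIMSEQ_const_iff)
qed

lemma partial_mult:
  fixes f g :: "real ^ 'n::finite \<Rightarrow> real"
  assumes "f differentiable (at x)" "g differentiable (at x)"
  shows "partial i (\<lambda>x. f x * g x) x = f x * partial i g x + partial i f x * g x"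
  using frechet_derivative_at[OF has_derivative_mult[OF
      assms[unfolded frechet_derivative_works]], symmetric]
  by (simp add: partial_def)

text \<open>For a Borel function vanishing off \<Omega>, neither the restriction to \<Omega> nor the
  completion of the measure changes the integral. Computations can thus be done with
  \<open>lborel\<close> on the whole space.\<close>

lemma set_lebesgue_integral_support:
  fixes f :: "'a::euclidean_space \<Rightarrow> real"
  assumes "f \<in> borel_measurable borel" "\<And>x. x \<notin> \<Omega> \<Longrightarrow> f x = 0"
  shows "(LINT x:\<Omega>|lebesgue. f x) = integral\<^sup>L lborel f"
proof -
  have "(\<lambda>x. indicator \<Omega> x *\<^sub>R f x) = f"
    using assms(2) by (auto simp: indicator_def fun_eq_iff)
  then show ?thesis
    using assms(1) by (simp add: set_lebesgue_integral_def integral_completion)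
qed

lemma L2_space_support:
  fixes f :: "real ^ 'n::finite \<Rightarrow> 'b::euclidean_space"
  assumes "continuous_on UNIV f" "compact K" "\<And>x. x \<notin> K \<Longrightarrow> f x = 0" "K \<subseteq> \<Omega>"
  shows "f \<in> L2_space \<Omega>"
proof -
  have 1: "(\<lambda>x. indicator \<Omega> x *\<^sub>R f x) = f"
    using assms(3,4) by (force simp: indicator_def fun_eq_iff)
  have 2: "(\<lambda>x. indicator \<Omega> x *\<^sub>R (norm (f x))\<^sup>2) = (\<lambda>x. (norm (f x))\<^sup>2)"
    using assms(3,4) by (force simp: indicator_def fun_eq_iff)
  have "integrable lborel (\<lambda>x. (norm (f x))\<^sup>2)"
    using assms by (intro integrable_compact_support[of _ K] continuous_intros) auto
  moreover have "f \<in> borel_measurable borel"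
    using assms(1) by (rule borel_measurable_continuous_onI)
  ultimately show ?thesis
    unfolding L2_space_def set_borel_measurable_def set_integrable_def mem_Collect_eq 1 2
    by (auto simp: integrable_completion intro: measurable_completion)
qed

text \<open>Integrate the product rule for \<open>v x $ j * \<phi> x\<close>: the product is
  compactly supported because \<open>v\<close> is, so its partial derivative has integral
  zero.\<close>

lemma has_H1_gradient_support:
  fixes v :: "real ^ 'n::finite \<Rightarrow> real ^ 'n"
  assumes v: "C_k 1 v" and K: "compact K" "\<And>x. x \<notin> K \<Longrightarrow> v x = 0" "K \<subseteq> \<Omega>"
  shows "has_H1_gradient \<Omega> v (grad v)"
  unfolding has_H1_gradient_def
proof (intro conjI ballI allI)
  have diff: "v differentiable (at x)" and cont: "continuous_on UNIV (partial i v)" for x i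
    using v by auto
  have contv: "continuous_on UNIV v"
    using diff by (intro continuous_at_imp_continuous_on) (auto intro: differentiable_imp_continuous_within)
  have out: "partial i v x = 0" if "x \<notin> K" for i x
    using partial_outside[OF compact_imp_closed[OF K(1)] K(2) that] .
  show "v \<in> L2_space \<Omega>"
    by (rule L2_space_support[OF contv K])
  show "grad v \<in> L2_space \<Omega>"
    by (rule L2_space_support[OF _ K(1) _ K(3)])
       (auto simp: grad_def out cont zero_vec_def[symmetric] intro!: continuous_on_vec_lambda
         simp: vec_eq_iff)
  fix \<phi> :: "real ^ 'n \<Rightarrow> real" and i j
  assume "\<phi> \<in> test_functions \<Omega>"
  then have "C_k 1 \<phi>" by (auto simp: test_functions_def)
  then have dphi: "\<phi> differentiable (at x)" and cphi: "continuous_on UNIV (partial i \<phi>)" for x by auto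
  have contp: "continuous_on UNIV \<phi>"
    using dphi by (intro continuous_at_imp_continuous_on) (auto intro: differentiable_imp_continuous_within)
  define f where "f x = v x $ j" for x
  have df: "f differentiable (at x)" for x
    unfolding f_def using diff bounded_linear_imp_differentiable[OF bounded_linear_vec_nth]
    by (rule differentiable_compose[rotated])
  have pf: "partial i f x = partial i v x $ j" for x
    using frechet_derivative_at[OF bounded_linear.has_derivative[OF bounded_linear_vec_nth
          diff[unfolded frechet_derivative_works, of x], of j], symmetric]
    by (simp add: partial_def f_def[abs_def])
  have cf: "continuous_on UNIV f" "continuous_on UNIV (partial i f)"
    using contv cont unfolding pf[abs_def] f_def by (auto intro!: continuous_intros)
  let ?g = "\<lambda>x. f x * \<phi> x"
  have pg: "partial i ?g x = f x * partial i \<phi> x + partial i f x * \<phi> x" for x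
    by (rule partial_mult[OF df dphi])
  have int: "integrable lborel (\<lambda>x. f x * partial i \<phi> x)" "integrable lborel (\<lambda>x. partial i f x * \<phi> x)"
    by (rule integrable_compact_support[OF _ K(1)];
        auto simp: f_def K(2) pf out intro!: continuous_intros contp cphi cf[unfolded f_def pf[abs_def]])+
  have "integral\<^sup>L lborel (partial i ?g) = 0"
  proof (rule integral_partial_eq_0[OF _ _ K(1)])
    show "?g differentiable (at x)" for x
      using df dphi by (rule differentiable_mult)
    show "continuous_on UNIV (partial i ?g)"
      unfolding pg[abs_def] by (intro continuous_intros cf cphi contp)
  qed (simp add: f_def K(2))
  then have "(LINT x|lborel. f x * partial i \<phi> x) = - (LINT x|lborel. partial i f x * \<phi> x)"
    unfolding pg[abs_def] using int by simp
  moreover have "(LINT x:\<Omega>|lebesgue. v x $ j * partial i \<phi> x) = (LINT x|lborel. f x * partial i \<phi> x)"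
    unfolding f_def[symmetric]
    by (rule set_lebesgue_integral_support)
       (use borel_measurable_integrable[OF int(1)] K(2)[OF contra_subsetD[OF K(3)]] in \<open>auto simp: f_def\<close>)
  moreover have "(LINT x:\<Omega>|lebesgue. grad v x $ i $ j * \<phi> x) = (LINT x|lborel. partial i f x * \<phi> x)"
    unfolding grad_def vec_lambda_beta pf[symmetric]
    by (rule set_lebesgue_integral_support)
       (use borel_measurable_integrable[OF int(2)] out[OF contra_subsetD[OF K(3)]] in \<open>auto simp: pf\<close>)
  ultimately show "(LINT x:\<Omega>|lebesgue. v x $ j * partial i \<phi> x) =
      - (LINT x:\<Omega>|lebesgue. grad v x $ i $ j * \<phi> x)" by simp
qed

lemma solenoidal_test_field_in_H1_0_sigma:
  fixes v :: "real ^ 'n::finite \<Rightarrow> real ^ 'n"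
  assumes "v \<in> solenoidal_test_fields \<Omega>" "has_H1_gradient \<Omega> v (grad v)"
  shows "v \<in> H1_0_sigma \<Omega>"
  unfolding H1_0_sigma_def mem_Collect_eq
  using assms by (intro exI[of _ "grad v"] conjI exI[of _ "\<lambda>_. v"])
    (auto simp: H1_norm_def L2_norm_def set_lebesgue_integral_def)

subsection \<open>Rotations and dilations of the plane\<close>

text \<open>The counterclockwise quarter turn, used in place of averaging over the full
  circle.\<close>

definition rot90 :: "real ^ 2 \<Rightarrow> real ^ 2" where
  "rot90 x = vector [- (x $ 2), x $ 1]"

lemma rot90_nth [simp]: "rot90 x $ 1 = - (x $ 2)" "rot90 x $ 2 = x $ 1"
  by (auto simp: rot90_def vector_2)

lemma inner_vec2: "x \<bullet> y = x $ 1 * y $ 1 + x $ 2 * y $ 2" for x y :: "real ^ 2"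
  by (simp add: inner_vec_def sum_2)

lemma rot90_inner [simp]: "rot90 x \<bullet> rot90 x = x \<bullet> x"
  by (simp add: inner_vec2)

lemma linear_rot90: "linear rot90"
  by (rule linearI) (auto simp: vec_eq_iff forall_2)

lemma measurable_rot90 [measurable]: "rot90 \<in> borel_measurable borel"
  using linear_rot90 by (intro borel_measurable_continuous_onI linear_continuous_on) (simp add: linear_conv_bounded_linear)

lemma Basis_2: "Basis = {axis 1 1, axis 2 1 :: real ^ 2}"
  by (auto simp: Basis_vec_def UNIV_2)

text \<open>Lebesgue measure is determined by its values on boxes, and the preimage of a box under a
  quarter turn is a box with the two side lengths exchanged.\<close>

lemma lborel_rot90: "distr lborel borel rot90 = lborel"
proof (rule sym, rule lborel_eqI)
  fix l u :: "real ^ 2"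
  assume le: "\<And>b. b \<in> Basis \<Longrightarrow> l \<bullet> b \<le> u \<bullet> b"
  have le': "l $ 1 \<le> u $ 1" "l $ 2 \<le> u $ 2"
    using le[of "axis 1 1"] le[of "axis 2 1"] by (simp_all add: inner_axis)
  have "rot90 -` box l u = box (vector [l $ 2, - (u $ 1)]) (vector [u $ 2, - (l $ 1)])"
    by (auto simp: mem_box_cart forall_2 vector_2)
  moreover have "emeasure lborel (box (vector [l $ 2, - (u $ 1)]) (vector [u $ 2, - (l $ 1)] :: real ^ 2)) =
      (\<Prod>b\<in>Basis. (u - l) \<bullet> b)"
    using le' by (subst emeasure_lborel_box) (auto simp: Basis_2 inner_axis vector_2 axis_eq_axis mult.commute)
  ultimately   show "emeasure (distr lborel borel rot90) (box l u) = (\<Prod>b\<in>Basis. (u - l) \<bullet> b)"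
    by (simp add: emeasure_distr)
qed simp

lemma integral_rot90:
  fixes f :: "real ^ 2 \<Rightarrow> real"
  assumes [measurable]: "f \<in> borel_measurable borel"
  shows "(LINT x|lborel. f (rot90 x)) = integral\<^sup>L lborel f"
proof -
  have "integral\<^sup>L lborel f = integral\<^sup>L (distr lborel borel rot90) f"
    by (simp add: lborel_rot90)
  also have "\<dots> = (LINT x|lborel. f (rot90 x))"
    by (subst integral_distr) auto
  finally show ?thesis ..
qed

text \<open>The bounds \<open>c\<close> and \<open>d\<close> refer to the squared radius; the
  half-open range lets consecutive rings fit together without overlap.\<close>

definition ring_weight :: "real \<Rightarrow> real \<Rightarrow> real ^ 2 \<Rightarrow> real" where
  "ring_weight c d x = indicator {x. c \<le> x \<bullet> x \<and> x \<bullet> x < d} x * inverse (x \<bullet> x)"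

lemma measurable_ring_weight [measurable]: "ring_weight c d \<in> borel_measurable borel"
  unfolding ring_weight_def[abs_def] by measurable

lemma ring_weight_nonneg: "0 \<le> ring_weight c d x"
  by (auto simp: ring_weight_def)

lemma integrable_ring_weight:
  assumes "0 < c"
  shows "integrable lborel (ring_weight c d)"
proof (rule Bochner_Integration.integrable_bound)
  have "emeasure lborel (cball (0::real^2) (sqrt d)) < \<infinity>"
    by (rule emeasure_bounded_finite) simp
  then show "integrable lborel (\<lambda>x::real^2. inverse c * indicator (cball 0 (sqrt d)) x)"
    by (intro integrable_mult_right) (simp add: integrable_indicator_iff)
  have "norm (ring_weight c d x) \<le> norm (inverse c * indicator (cball 0 (sqrt d)) x)" for x
  proof (cases "c \<le> x \<bullet> x \<and> x \<bullet> x < d")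
    case True
    then have "x \<in> cball 0 (sqrt d)" by (simp add: norm_eq_sqrt_inner)
    moreover have "inverse (x \<bullet> x) \<le> inverse c"
      using True assms by (intro le_imp_inverse_le) auto
    ultimately show ?thesis
      using True assms by (simp add: ring_weight_def)
  next
    case False
    then show ?thesis by (simp add: ring_weight_def)
  qed
  then show "AE x in lborel. norm (ring_weight c d x) \<le> norm (inverse c * indicator (cball 0 (sqrt d)) x)"
    by (intro AE_I2)
qed simp

text \<open>The weight \<open>1 / (x \<bullet> x)\<close> is invariant under dilations of the plane, so the integrals over
  rings with the same ratio of radii agree.\<close>

lemma integral_ring_weight_dilation:
  assumes "0 < l"
  shows "integral\<^sup>L lborel (ring_weight (l\<^sup>2 * c) (l\<^sup>2 * d)) = integral\<^sup>L lborel (ring_weight c d)"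
proof -
  let ?f = "ring_weight (l\<^sup>2 * c) (l\<^sup>2 * d)"
  have f: "?f (0 + l *\<^sub>R x) = inverse (l\<^sup>2) * ring_weight c d x" for x
  proof -
    have "(l *\<^sub>R x) \<bullet> (l *\<^sub>R x) = l\<^sup>2 * (x \<bullet> x)" by (simp add: power2_eq_square)
    then show ?thesis
      using assms by (simp add: ring_weight_def indicator_def del: inner_scaleR_left inner_scaleR_right)
  qed
  \<comment> \<open>The Jacobian of the dilation, l^2 in dimension two, cancels the factor 1/l^2
    picked up by the weight.\<close>
  have "integral\<^sup>L lborel ?f =
      integral\<^sup>L (density (distr lborel borel (\<lambda>x. 0 + l *\<^sub>R x)) (\<lambda>_. \<bar>l\<bar> ^ DIM(real^2))) ?f"
    using lborel_affine[of l "0 :: real^2"] assms by simp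
  also have "\<dots> = \<bar>l\<bar> ^ DIM(real^2) * (LINT x|lborel. ?f (0 + l *\<^sub>R x))"
    by (subst integral_density) (auto simp: integral_distr)
  also have "\<dots> = integral\<^sup>L lborel (ring_weight c d)"
    unfolding f using assms by simp
  finally show ?thesis .
qed

subsection \<open>Slowly rotating fields\<close>

text \<open>Here (p, s) is the point, (-s, p) its quarter turn and E = 1/|x|^2; the profiles are
  radial and so take the same values at both points. \<open>v12\<close> stands for the partial
  derivative of \<open>v1\<close> in direction 2, and \<open>n\<close> for the convective term
  paired with (-s, p). In the sum all products of two differentiated profiles cancel.\<close>

lemma convection_algebra:
  fixes p s a b a1 b1 a2 b2 E :: real
  assumes E: "(p * p + s * s) * E = 1"
  defines "w \<equiv> \<lambda>p s. 2 * (a1 * E * p + b1 * E * s)"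
  defines "w1 \<equiv> \<lambda>p s. 2 * (a1 * E + 2 * p * E * E * ((a2 - a1) * p + (b2 - b1) * s))"
  defines "w2 \<equiv> \<lambda>p s. 2 * (b1 * E + 2 * s * E * E * ((a2 - a1) * p + (b2 - b1) * s))"
  defines "v1 \<equiv> \<lambda>p s. b + s * w p s" and "v2 \<equiv> \<lambda>p s. - (a + p * w p s)"
  defines "v11 \<equiv> \<lambda>p s. 2 * p * (b1 * E) + s * w1 p s"
  defines "v12 \<equiv> \<lambda>p s. 2 * s * (b1 * E) + w p s + s * w2 p s"
  defines "v21 \<equiv> \<lambda>p s. - (2 * p * (a1 * E) + w p s + p * w1 p s)"
  defines "v22 \<equiv> \<lambda>p s. - (2 * s * (a1 * E) + p * w2 p s)"
  defines "n \<equiv> \<lambda>p s. (v1 p s * v11 p s + v2 p s * v12 p s) * (- s) + (v1 p s * v21 p s + v2 p s * v22 p s) * p"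
  shows "n p s + n (- s) p = 4 * ((a * b1 - b * a1) + (a * b2 - b * a2))"
  using E unfolding n_def v11_def v12_def v21_def v22_def v1_def v2_def w_def w1_def w2_def by algebra

text \<open>The field below is \<open>(\<partial>\<^sub>2\<psi>, - \<partial>\<^sub>1\<psi>)\<close> for the stream function
  \<open>\<psi> x = x\<^sub>1 a (ln |x|\<^sup>2) + x\<^sub>2 b (ln |x|\<^sup>2)\<close>.\<close>

locale swirl =
  fixes a b a1 b1 a2 b2 :: "real \<Rightarrow> real" and t0 t1 :: real
  assumes elem_smooth: "elem_smooth a" "elem_smooth b" "elem_smooth a1" "elem_smooth b1"
    and deriv: "\<And>t. (a has_real_derivative a1 t) (at t)" "\<And>t. (b has_real_derivative b1 t) (at t)"
      "\<And>t. (a1 has_real_derivative a2 t) (at t)" "\<And>t. (b1 has_real_derivative b2 t) (at t)"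
    and support: "\<And>t. t \<notin> {t0..t1} \<Longrightarrow> a t = 0" "\<And>t. t \<notin> {t0..t1} \<Longrightarrow> b t = 0"
    and t0: "1 \<le> t0"
begin

abbreviation tau :: "real ^ 2 \<Rightarrow> real" where
  "tau x \<equiv> ln (x \<bullet> x)"

text \<open>Equal to 1/|x|^2 away from the origin; written through \<open>tau\<close> so that its
  products with radial profiles are radial profiles.\<close>

definition E :: "real ^ 2 \<Rightarrow> real" where
  "E x = exp (- tau x)"

text \<open>\<open>x $ i * w x\<close> is what the chain rule contributes to the i-th partial
  derivative of the stream function when the profiles are differentiated.\<close>

definition w :: "real ^ 2 \<Rightarrow> real" where
  "w x = 2 * (a1 (tau x) * E x * x $ 1 + b1 (tau x) * E x * x $ 2)"

definition v :: "real ^ 2 \<Rightarrow> real ^ 2" where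
  "v x = vector [b (tau x) + x $ 2 * w x, - (a (tau x) + x $ 1 * w x)]"

text \<open>The differences \<open>a2 - a1\<close> and \<open>b2 - b1\<close> come from
  differentiating a1(t) exp(-t) and b1(t) exp(-t); the i-th partial derivative of \<open>tau\<close>
  is \<open>2 * x $ i * E x\<close>.\<close>

definition dw :: "2 \<Rightarrow> real ^ 2 \<Rightarrow> real" where
  "dw i x = 2 * ((if i = 1 then a1 (tau x) else b1 (tau x)) * E x +
     2 * x $ i * E x * E x * ((a2 (tau x) - a1 (tau x)) * x $ 1 + (b2 (tau x) - b1 (tau x)) * x $ 2))"

text \<open>Index order: \<open>dv j i\<close> is the i-th partial derivative of component j, the
  transpose of \<open>grad\<close>.\<close>

definition dv :: "2 \<Rightarrow> 2 \<Rightarrow> real ^ 2 \<Rightarrow> real" where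
  "dv j i x =
     (if j = 1 then 2 * x $ i * (b1 (tau x) * E x) + (if i = 2 then w x else 0) + x $ 2 * dw i x
      else - (2 * x $ i * (a1 (tau x) * E x) + (if i = 1 then w x else 0) + x $ 1 * dw i x))"

section \<open>Smoothness, derivatives and divergence of the field\<close>

lemma support': "t \<notin> {t0..t1} \<Longrightarrow> a1 t = 0" "t \<notin> {t0..t1} \<Longrightarrow> b1 t = 0"
    "t \<notin> {t0..t1} \<Longrightarrow> a2 t = 0" "t \<notin> {t0..t1} \<Longrightarrow> b2 t = 0"
proof -
  have op: "open (- {t0..t1})" by (intro open_Compl closed_atLeastAtMost)
  have 1: "a1 t = 0" if "t \<notin> {t0..t1}" for t
    by (rule has_real_derivative_zero[OF deriv(1) op]) (use that support in auto)
  have 2: "b1 t = 0" if "t \<notin> {t0..t1}" for t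
    by (rule has_real_derivative_zero[OF deriv(2) op]) (use that support in auto)
  show "t \<notin> {t0..t1} \<Longrightarrow> a1 t = 0" "t \<notin> {t0..t1} \<Longrightarrow> b1 t = 0" using 1 2 by blast+
  show "a2 t = 0" if "t \<notin> {t0..t1}"
    by (rule has_real_derivative_zero[OF deriv(3) op]) (use that 1 in auto)
  show "b2 t = 0" if "t \<notin> {t0..t1}"
    by (rule has_real_derivative_zero[OF deriv(4) op]) (use that 2 in auto)
qed

lemma vanish: "t < 1 \<Longrightarrow> a t = 0" "t < 1 \<Longrightarrow> b t = 0" "t < 1 \<Longrightarrow> a1 t = 0" "t < 1 \<Longrightarrow> b1 t = 0"
  using support[of t] support'[of t] t0 by auto

lemma elem_field_w: "elem_field w"
proof -
  have "elem_smooth (\<lambda>t. f t * exp (- t))" if "elem_smooth f" for f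
    using elem_smooth.mult[OF that elem_smooth.exp[of "-1" 0]] by simp
  from elem_field.radial[OF this[OF elem_smooth(3)]] elem_field.radial[OF this[OF elem_smooth(4)]]
  have "elem_field (\<lambda>x::real^2. a1 (tau x) * E x)" "elem_field (\<lambda>x::real^2. b1 (tau x) * E x)"
    by (simp_all add: vanish E_def)
  note this[THEN elem_field.mult, OF elem_field.coord]
  then show ?thesis
    unfolding w_def[abs_def] by (intro elem_field.mult[OF elem_field.const] elem_field.add)
qed

lemma elem_field_v: "elem_field (\<lambda>x. v x $ j)"
proof -
  have ab: "elem_field (\<lambda>x::real^2. a (tau x))" "elem_field (\<lambda>x::real^2. b (tau x))"
    using elem_smooth vanish by (auto intro: elem_field.radial)
  have "elem_field (\<lambda>x. b (tau x) + x $ 2 * w x)" "elem_field (\<lambda>x. - (a (tau x) + x $ 1 * w x))"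
    by (rule elem_field.add[OF ab(2) elem_field.mult[OF elem_field.coord elem_field_w]],
        rule elem_field_minus[OF elem_field.add[OF ab(1) elem_field.mult[OF elem_field.coord elem_field_w]]])
  then show ?thesis
    using exhaust_2[of j] by (auto simp: v_def vector_2)
qed

lemma has_partials_w: "has_partials w dw"
proof -
  have 1: "has_partials (\<lambda>x::real^2. f (tau x) * exp (- tau x))
      (\<lambda>i x. 2 * x $ i * ((f' (tau x) - f (tau x)) * exp (- tau x) * exp (- tau x)))"
    if "\<And>t. (f has_real_derivative f' t) (at t)" "\<And>t. t < 1 \<Longrightarrow> f t = 0" for f f'
    by (rule has_partials_radial[where g' = "\<lambda>t. (f' t - f t) * exp (- t)"])
       (auto intro!: derivative_eq_intros that simp: that algebra_simps)
  note A = 1[OF deriv(3) vanish(3)] and B = 1[OF deriv(4) vanish(4)]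
  show ?thesis
    by (rule has_partials_cong[OF has_partials_mult[OF has_partials_const[of 2]
          has_partials_add[OF has_partials_mult[OF A has_partials_coord[of 1]]
            has_partials_mult[OF B has_partials_coord[of 2]]]]])
       (use exhaust_2 in \<open>auto simp: w_def dw_def E_def axis_def algebra_simps\<close>)
qed

lemma has_partials_v: "has_partials (\<lambda>x. v x $ j) (dv j)"
proof -
  note A = has_partials_radial[OF deriv(1) vanish(1)] and B = has_partials_radial[OF deriv(2) vanish(2)]
  have "has_partials (\<lambda>x. v x $ 1) (dv 1)"
    by (rule has_partials_cong[OF has_partials_add[OF B has_partials_mult[OF
          has_partials_coord[of 2] has_partials_w]]])
       (auto simp: v_def dv_def vector_2 axis_def E_def)
  moreover have "has_partials (\<lambda>x. v x $ 2) (dv 2)"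
    by (rule has_partials_cong[OF has_partials_minus[OF has_partials_add[OF A has_partials_mult[OF
          has_partials_coord[of 1] has_partials_w]]]])
       (auto simp: v_def dv_def vector_2 axis_def E_def)
  ultimately show ?thesis
    using exhaust_2[of j] by auto
qed

lemma grad_v: "grad v x $ i $ j = dv j i x"
  unfolding grad_def by (simp add: partial_vec[of v dv, OF has_partials_v])

lemma divergence_v: "divergence v x = 0"
proof -
  have "divergence v x = dv 1 1 x + dv 2 2 x"
    by (simp add: divergence_def sum_2 partial_vec[of v dv, OF has_partials_v])
  also have "\<dots> = 0"
    by (simp add: dv_def dw_def algebra_simps)
  finally show ?thesis .
qed

section \<open>The annulus that carries the field\<close>

definition K :: "(real ^ 2) set" where
  "K = {x. exp t0 \<le> x \<bullet> x \<and> x \<bullet> x \<le> exp t1}"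

lemma tau_K:
  assumes "x \<noteq> 0"
  shows "x \<in> K \<longleftrightarrow> tau x \<in> {t0..t1}"
proof -
  have "x \<bullet> x = exp (tau x)" using assms by simp
  then have "x \<in> K \<longleftrightarrow> exp t0 \<le> exp (tau x) \<and> exp (tau x) \<le> exp t1"
    unfolding K_def by simp
  then show ?thesis by simp
qed

lemma outside:
  assumes "x \<notin> K"
  shows "a (tau x) = 0" "b (tau x) = 0" "a1 (tau x) = 0" "b1 (tau x) = 0"
    "a2 (tau x) = 0" "b2 (tau x) = 0"
proof -
  \<comment> \<open>The origin is a case of its own: \<open>ln 0 = 0\<close> gives
    \<open>tau 0 = 0\<close>, which lies below \<open>t0\<close>.\<close>
  have "tau x \<notin> {t0..t1}" using tau_K[of x] assms t0 by (cases "x = 0") auto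
  then show "a (tau x) = 0" "b (tau x) = 0" "a1 (tau x) = 0" "b1 (tau x) = 0"
    "a2 (tau x) = 0" "b2 (tau x) = 0" using support support' by auto
qed

lemma v_outside: "x \<notin> K \<Longrightarrow> v x = 0"
  by (simp add: v_def w_def outside vec_eq_iff forall_2 vector_2)

lemma dv_outside: "x \<notin> K \<Longrightarrow> dv j i x = 0"
  by (simp add: dv_def dw_def w_def outside)

lemma compact_K: "compact K"
proof -
  have "K = {x. exp t0 \<le> x \<bullet> x} \<inter> {x. x \<bullet> x \<le> exp t1}" by (auto simp: K_def)
  also have "closed \<dots>"
    by (intro closed_Int closed_Collect_le continuous_intros)
  finally have "closed K" .
  moreover have "bounded K"
    by (rule boundedI[of _ "sqrt (exp t1)"]) (auto simp: K_def norm_eq_sqrt_inner)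
  ultimately show ?thesis by (simp add: compact_eq_bounded_closed)
qed

lemma C_k_v: "C_k k v"
  by (rule elem_field_C_k) (rule elem_field_v)

lemma v_test_field:
  assumes "K \<subseteq> \<Omega>"
  shows "v \<in> solenoidal_test_fields \<Omega>"
proof -
  have "closure {x. v x \<noteq> 0} \<subseteq> K"
    using v_outside compact_K by (intro closure_minimal compact_imp_closed) auto
  moreover from this have "compact (closure {x. v x \<noteq> 0})"
    using compact_K by (metis closed_closure compact_Int_closed inf.absorb2)
  ultimately show ?thesis
    using C_k_v assms divergence_v by (auto simp: solenoidal_test_fields_def test_functions_def)
qed

lemma gradient_v: "K \<subseteq> \<Omega> \<Longrightarrow> has_H1_gradient \<Omega> v (grad v)"
  by (rule has_H1_gradient_support[OF C_k_v compact_K v_outside])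

text \<open>Every term of \<open>dv\<close> contains a derivative of a profile, never
  \<open>a\<close> or \<open>b\<close> themselves, so small profile derivatives make the gradient
  small. Each term scales like m/|x|, and 576 is 24^2.\<close>

lemma dv_bound:
  assumes "x \<noteq> 0" and m: "\<bar>a1 (tau x)\<bar> \<le> m" "\<bar>b1 (tau x)\<bar> \<le> m" "\<bar>a2 (tau x)\<bar> \<le> m" "\<bar>b2 (tau x)\<bar> \<le> m"
  shows "(dv j i x)\<^sup>2 \<le> 576 * m\<^sup>2 * inverse (x \<bullet> x)"
proof -
  define r where "r = norm x"
  have r: "r > 0" using assms by (simp add: r_def)
  have xr: "\<bar>x $ i\<bar> \<le> r" for i unfolding r_def by (rule component_le_norm_cart)
  have E: "E x = inverse (r * r)"
    using assms by (simp add: E_def r_def exp_minus power2_norm_eq_inner[symmetric] power2_eq_square)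
  have m0: "m \<ge> 0" using m by linarith
  have Ep: "E x > 0" by (simp add: E_def)
  have prod: "\<bar>y * z\<bar> \<le> c * d" if "\<bar>y\<bar> \<le> c" "\<bar>z\<bar> \<le> d" for y z c d :: real
    using that by (auto simp: abs_mult intro!: mult_mono)
  have add: "\<bar>y + z\<bar> \<le> c + d" if "\<bar>y\<bar> \<le> c" "\<bar>z\<bar> \<le> d" for y z c d :: real
    using that by linarith
  have two: "\<bar>2::real\<bar> \<le> 2" by simp
  have Eb: "\<bar>E x\<bar> \<le> E x" using Ep by simp
  have bw: "\<bar>w x\<bar> \<le> 4 * m * E x * r"
  proof -
    have "\<bar>a1 (tau x) * E x * x $ 1\<bar> \<le> m * E x * r" "\<bar>b1 (tau x) * E x * x $ 2\<bar> \<le> m * E x * r"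
      by (intro prod m Eb xr)+
    from prod[OF two add[OF this]] show ?thesis unfolding w_def by (simp add: mult_ac)
  qed
  have bdw: "\<bar>dw i x\<bar> \<le> 18 * m * E x"
  proof -
    have 1: "\<bar>(if i = 1 then a1 (tau x) else b1 (tau x)) * E x\<bar> \<le> m * E x"
      using m by (intro prod Eb) auto
    have "\<bar>(a2 (tau x) - a1 (tau x)) * x $ 1\<bar> \<le> (2 * m) * r" "\<bar>(b2 (tau x) - b1 (tau x)) * x $ 2\<bar> \<le> (2 * m) * r"
      by (intro prod xr; use m in linarith)+
    then have "\<bar>(a2 (tau x) - a1 (tau x)) * x $ 1 + (b2 (tau x) - b1 (tau x)) * x $ 2\<bar> \<le> 4 * m * r"
      by linarith
    then have "\<bar>2 * x $ i * E x * E x * ((a2 (tau x) - a1 (tau x)) * x $ 1 + (b2 (tau x) - b1 (tau x)) * x $ 2)\<bar>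
        \<le> 2 * r * E x * E x * (4 * m * r)"
      by (intro prod Eb xr) auto
    also have "\<dots> = 8 * m * E x" using r by (simp add: E)
    finally have 2: "\<bar>2 * x $ i * E x * E x * ((a2 (tau x) - a1 (tau x)) * x $ 1 + (b2 (tau x) - b1 (tau x)) * x $ 2)\<bar>
        \<le> 8 * m * E x" .
    have "\<bar>dw i x\<bar> \<le> 2 * (m * E x + 8 * m * E x)"
      unfolding dw_def by (rule prod[OF two add[OF 1 2]])
    then show ?thesis by simp
  qed
  have bd: "\<bar>x $ l * dw i x\<bar> \<le> r * (18 * m * E x)" for l
    by (intro prod xr bdw)
  have ba: "\<bar>2 * x $ i * (f * E x)\<bar> \<le> 2 * r * (m * E x)" if "\<bar>f\<bar> \<le> m" for f
    using that by (intro prod Eb xr) auto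
  \<comment> \<open>The three groups of terms contribute 2 + 4 + 18 = 24.\<close>
  have "\<bar>dv j i x\<bar> \<le> 24 * m * E x * r"
  proof -
    have "\<bar>if P then w x else 0\<bar> \<le> 4 * m * E x * r" for P
      using bw m0 Ep r by auto
    then have "\<bar>dv j i x\<bar> \<le> 2 * r * (m * E x) + 4 * m * E x * r + r * (18 * m * E x)"
      using bd[of 1] bd[of 2] ba[OF m(1)] ba[OF m(2)] unfolding dv_def by (smt (verit, ccfv_threshold))
    then show ?thesis by (simp add: algebra_simps)
  qed
  then have "\<bar>dv j i x\<bar>\<^sup>2 \<le> (24 * m * E x * r)\<^sup>2"
    by (intro power_mono) auto
  also have "\<dots> = 576 * m\<^sup>2 * inverse (x \<bullet> x)"
    using r by (simp add: E power2_eq_square field_simps r_def power2_norm_eq_inner[symmetric])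
  finally show ?thesis by simp
qed

section \<open>Convective and Dirichlet integrals\<close>

definition convection_density :: "real \<Rightarrow> real ^ 2 \<Rightarrow> real" where
  "convection_density \<mu> x = convection v (grad v) x \<bullet> circular_flow \<mu> x"

text \<open>The circular flow is mu/(2 pi |y|^2) times the quarter turn of \<open>y\<close>, so the
  bracket is the quantity \<open>n\<close> of \<open>convection_algebra\<close>.\<close>

lemma convection_density_eq:
  assumes "y \<noteq> 0"
  shows "convection_density \<mu> y = \<mu> / (2 * pi) * E y *
    ((v y $ 1 * dv 1 1 y + v y $ 2 * dv 1 2 y) * (- (y $ 2)) +
     (v y $ 1 * dv 2 1 y + v y $ 2 * dv 2 2 y) * y $ 1)"
proof -
  have "E y = 1 / norm y * (1 / norm y)"
    using assms by (simp add: E_def exp_minus power2_norm_eq_inner[symmetric] power2_eq_square divide_inverse)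
  then have u: "circular_flow \<mu> y $ 1 = \<mu> / (2 * pi) * E y * (- (y $ 2))"
      "circular_flow \<mu> y $ 2 = \<mu> / (2 * pi) * E y * y $ 1"
    by (simp_all add: circular_flow_def e_theta_def vector_2)
  have c: "convection v (grad v) y $ j = v y $ 1 * dv j 1 y + v y $ 2 * dv j 2 y" for j
    by (simp add: convection_def sum_2 grad_v)
  show ?thesis
    unfolding convection_density_def inner_vec2 u c by (simp only: algebra_simps)
qed

lemma convection_density_outside:
  assumes "x \<notin> K"
  shows "convection_density \<mu> x = 0"
proof -
  have "convection v (grad v) x = 0"
    by (simp add: convection_def v_outside[OF assms] zero_vec_def)
  then show ?thesis by (simp add: convection_density_def)
qed

lemma continuous_v: "continuous_on UNIV (\<lambda>x. v x $ j)"
  by (intro elem_field_continuous elem_field_v)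

text \<open>Uniqueness of partial derivatives identifies \<open>dv j i\<close> with a member of
  \<open>elem_field\<close>.\<close>

lemma continuous_dv: "continuous_on UNIV (dv j i)"
proof -
  obtain f' where "has_partials (\<lambda>x. v x $ j) f'" "elem_field (f' i)"
    using elem_field_partials[OF elem_field_v[of j]] by blast
  then have "elem_field (dv j i)"
    using partial_unique[of "\<lambda>x. v x $ j" f' i] partial_unique[OF has_partials_v, of i j] by simp
  then show ?thesis by (rule elem_field_continuous)
qed

text \<open>The circular flow is singular at the origin, so continuity is established only on
  \<open>K\<close>, which excludes the origin; off \<open>K\<close> the integrand vanishes because
  \<open>v\<close> does.\<close>

lemma integrable_density: "integrable lborel (convection_density \<mu>)"
proof -
  have K0: "x \<noteq> 0" if "x \<in> K" for x using that by (auto simp: K_def)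
  have cv: "continuous_on K (\<lambda>x. v x $ j)" "continuous_on K (dv j i)" for i j
    using continuous_v continuous_dv by (auto intro: continuous_on_subset)
  have "continuous_on K E"
    unfolding E_def[abs_def] by (intro continuous_intros) (use K0 in auto)
  then have "continuous_on K (convection_density \<mu>)"
    by (subst continuous_on_cong[OF refl convection_density_eq[OF K0]]) (auto intro!: continuous_intros cv)
  then have "integrable lborel (\<lambda>x. indicator K x *\<^sub>R convection_density \<mu> x)"
    by (intro borel_integrable_compact compact_K)
  moreover have "(\<lambda>x. indicator K x *\<^sub>R convection_density \<mu> x) = convection_density \<mu>"
    by (auto simp: indicator_def fun_eq_iff convection_density_outside)
  ultimately show ?thesis by simp
qed

lemma L2_inner_v:
  assumes "K \<subseteq> \<Omega>"
  shows "L2_inner \<Omega> (convection v (grad v)) (circular_flow \<mu>) = integral\<^sup>L lborel (convection_density \<mu>)"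
  unfolding L2_inner_def convection_density_def[symmetric]
  by (rule set_lebesgue_integral_support)
     (use assms borel_measurable_integrable[OF integrable_density] convection_density_outside in auto)

lemma norm_grad_v: "(norm (grad v x))\<^sup>2 = (dv 1 1 x)\<^sup>2 + (dv 2 1 x)\<^sup>2 + (dv 1 2 x)\<^sup>2 + (dv 2 2 x)\<^sup>2"
  unfolding power2_norm_eq_inner
  by (simp add: inner_vec_def sum_2 grad_v power2_eq_square)

lemma integrable_grad_v: "integrable lborel (\<lambda>x. (norm (grad v x))\<^sup>2)"
  unfolding norm_grad_v
  by (rule integrable_compact_support[OF _ compact_K])
     (auto intro!: continuous_intros continuous_dv simp: dv_outside)

lemma L2_norm_grad_v:
  assumes "K \<subseteq> \<Omega>"
  shows "(L2_norm \<Omega> (grad v))\<^sup>2 = (LINT x|lborel. (norm (grad v x))\<^sup>2)"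
proof -
  have "(LINT x:\<Omega>|lebesgue. (norm (grad v x))\<^sup>2) = (LINT x|lborel. (norm (grad v x))\<^sup>2)"
    by (rule set_lebesgue_integral_support[OF borel_measurable_integrable[OF integrable_grad_v, simplified]])
       (simp add: norm_grad_v dv_outside[OF contra_subsetD[OF assms]])
  then show ?thesis
    unfolding L2_norm_def by simp
qed

text \<open>Invariance of Lebesgue measure under the quarter turn allows the integrand to be
  symmetrised.\<close>

lemma two_integral_density:
  "2 * integral\<^sup>L lborel (convection_density \<mu>) = (LINT x|lborel. convection_density \<mu> x + convection_density \<mu> (rot90 x))"
  "integrable lborel (\<lambda>x. convection_density \<mu> x + convection_density \<mu> (rot90 x))"
proof -
  have [measurable]: "convection_density \<mu> \<in> borel_measurable borel"
    using borel_measurable_integrable[OF integrable_density] by simp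
  have "integrable (distr lborel borel rot90) (convection_density \<mu>)"
    by (simp add: lborel_rot90 integrable_density)
  then have int: "integrable lborel (\<lambda>x. convection_density \<mu> (rot90 x))"
    by (subst (asm) integrable_distr_eq) auto
  then show "integrable lborel (\<lambda>x. convection_density \<mu> x + convection_density \<mu> (rot90 x))"
    by (intro Bochner_Integration.integrable_add integrable_density)
  show "2 * integral\<^sup>L lborel (convection_density \<mu>) = (LINT x|lborel. convection_density \<mu> x + convection_density \<mu> (rot90 x))"
    using int by (simp add: integrable_density integral_rot90)
qed

text \<open>By \<open>convection_algebra\<close> the angular dependence cancels. What remains is the
  Wronskian a b' - b a', which measures the turning of the profile vector, plus its derivative a b''
  - b a''.\<close>

lemma convection_density_rot90:
  "convection_density \<mu> x + convection_density \<mu> (rot90 x) = 2 * \<mu> / pi * inverse (x \<bullet> x) *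
     ((a (tau x) * b1 (tau x) - b (tau x) * a1 (tau x)) + (a (tau x) * b2 (tau x) - b (tau x) * a2 (tau x)))"
proof (cases "x = 0")
  case True
  \<comment> \<open>Both sides vanish at the origin, the right one because
    \<open>inverse 0 = 0\<close>.\<close>
  have "(0::real^2) \<notin> K" by (simp add: K_def)
  then have "convection v (grad v) 0 = 0"
    by (simp add: convection_def v_outside zero_vec_def)
  moreover have "rot90 0 = 0" by (simp add: vec_eq_iff forall_2)
  ultimately show ?thesis using True by (simp add: convection_density_def)
next
  case False
  have E: "(x $ 1 * x $ 1 + x $ 2 * x $ 2) * E x = 1"
    using False by (simp add: E_def exp_minus inner_vec2[symmetric])
  have [simp]: "E (rot90 x) = E x" by (simp add: E_def)
  have "rot90 x \<noteq> 0" using False rot90_inner[of x] by force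
  from convection_density_eq[OF False] convection_density_eq[OF this]
  have step: "convection_density \<mu> x + convection_density \<mu> (rot90 x) = \<mu> / (2 * pi) * E x *
      (4 * ((a (tau x) * b1 (tau x) - b (tau x) * a1 (tau x)) +
        (a (tau x) * b2 (tau x) - b (tau x) * a2 (tau x))))"
    unfolding convection_algebra[OF E, symmetric]
    by (simp add: v_def vector_2 dv_def dw_def w_def distrib_left)
  have "\<mu> / (2 * pi) * e * (4 * y) = 2 * \<mu> / pi * e * y" for e y
    by (simp add: field_simps)
  moreover have "E x = inverse (x \<bullet> x)"
    using False by (simp add: E_def exp_minus)
  ultimately show ?thesis unfolding step by presburger
qed

end

subsection \<open>The choice of the profiles\<close>

lemma bump_exists:
  obtains h h1 h2 :: "real \<Rightarrow> real" and M where
    "elem_smooth h" "elem_smooth h1"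
    "\<And>t. (h has_real_derivative h1 t) (at t)" "\<And>t. (h1 has_real_derivative h2 t) (at t)"
    "\<And>t. t \<notin> {1..4} \<Longrightarrow> h t = 0" "\<And>t. t \<in> {2..3} \<Longrightarrow> exp (- 2) \<le> h t"
    "\<And>t. \<bar>h t\<bar> \<le> M" "\<And>t. \<bar>h1 t\<bar> \<le> M" "\<And>t. \<bar>h2 t\<bar> \<le> M" "0 < M"
proof -
  \<comment> \<open>The first factor is positive exactly for t > 1, the second exactly for t <
    4.\<close>
  define h where "h t = flat 1 (1 * t + - 1) * flat 1 (- 1 * t + 4)" for t
  have h: "elem_smooth h"
    unfolding h_def by (intro elem_smooth.intros)
  obtain h1 where h1: "elem_smooth h1" "\<And>t. (h has_real_derivative h1 t) (at t)"
    using elem_smooth_derivative[OF h] by blast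
  obtain h2 where h2: "elem_smooth h2" "\<And>t. (h1 has_real_derivative h2 t) (at t)"
    using elem_smooth_derivative[OF h1(1)] by blast
  have out: "h t = 0" if "t \<notin> {1..4}" for t
    using that by (auto simp: h_def flat_def)
  have op: "open (- {1..4::real})" by (intro open_Compl closed_atLeastAtMost)
  have out1: "h1 t = 0" if "t \<notin> {1..4}" for t
    by (rule has_real_derivative_zero[OF h1(2) op]) (use that out in auto)
  have out2: "h2 t = 0" if "t \<notin> {1..4}" for t
    by (rule has_real_derivative_zero[OF h2(2) op]) (use that out1 in auto)
  have cont: "continuous_on UNIV f" if "elem_smooth f" for f
    using elem_smooth_derivative[OF that]
    by (blast intro: continuous_at_imp_continuous_on DERIV_isCont)
  obtain M0 where M0: "\<And>t. \<bar>h t\<bar> \<le> M0" "0 \<le> M0"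
    using bounded_compact_support[OF cont[OF h] compact_Icc out] by blast
  obtain M1 where M1: "\<And>t. \<bar>h1 t\<bar> \<le> M1" "0 \<le> M1"
    using bounded_compact_support[OF cont[OF h1(1)] compact_Icc out1] by blast
  obtain M2 where M2: "\<And>t. \<bar>h2 t\<bar> \<le> M2" "0 \<le> M2"
    using bounded_compact_support[OF cont[OF h2(1)] compact_Icc out2] by blast
  have "exp (- 2) \<le> h t" if "t \<in> {2..3}" for t
  proof -
    have nonneg: "0 \<le> flat 1 u" for u by (simp add: flat_def)
    \<comment> \<open>On [2, 3] both arguments, t - 1 and 4 - t, are at least 1, so each factor is
      at least exp(-1).\<close>
    have "exp (- 1) \<le> flat 1 u" if "1 \<le> u" for u
      using that by (auto simp: flat_def inverse_le_1_iff)
    then have "exp (- 1) * exp (- 1) \<le> h t"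
      unfolding h_def using that by (intro mult_mono) (auto simp: nonneg)
    then show ?thesis by (simp add: exp_add[symmetric])
  qed
  \<comment> \<open>One constant serves all three functions; the added 1 makes it positive.\<close>
  moreover have "\<bar>h t\<bar> \<le> M0 + M1 + M2 + 1" "\<bar>h1 t\<bar> \<le> M0 + M1 + M2 + 1" "\<bar>h2 t\<bar> \<le> M0 + M1 + M2 + 1" for t
    using M0(1)[of t] M1(1)[of t] M2(1)[of t] M0(2) M1(2) M2(2) by linarith+
  ultimately show ?thesis
    using that[OF h h1(1) h1(2) h2(2) out, of "M0 + M1 + M2 + 1"] M0 M1 M2 by auto
qed

lemma has_real_derivative_scale:
  fixes f :: "real \<Rightarrow> real"
  assumes "\<And>t. (f has_real_derivative f' t) (at t)"
  shows "((\<lambda>t. c * f (k * t)) has_real_derivative c * (k * f' (k * t))) (at t)"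
proof -
  have "((\<lambda>t. k * t) has_real_derivative k) (at t)"
    by (auto intro!: derivative_eq_intros)
  from DERIV_cmult[OF DERIV_chain2[OF assms this], of c] show ?thesis
    by (simp add: mult.commute[of "f' (k * t)"])
qed

text \<open>The set where a continuous function is nonzero is open, and a nonempty open set is not
  null; vanishing off \<Omega> lets the whole space replace \<Omega>.\<close>

lemma not_AE_zero:
  fixes v :: "'a::euclidean_space \<Rightarrow> 'b::real_normed_vector"
  assumes "continuous_on UNIV v" "v x \<noteq> 0" "\<And>x. x \<notin> \<Omega> \<Longrightarrow> v x = 0"
  shows "\<not> (AE x in lebesgue. x \<in> \<Omega> \<longrightarrow> v x = 0)"
proof
  assume "AE x in lebesgue. x \<in> \<Omega> \<longrightarrow> v x = 0"
  then have AE: "AE x in lebesgue. v x = 0"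
    by (rule AE_mp) (use assms(3) in auto)
  have op: "open {x. v x \<noteq> 0}"
    using assms(1) by (intro open_Collect_neq) auto
  then have "{x. v x \<noteq> 0} \<in> null_sets lebesgue"
    using AE by (subst (asm) AE_iff_null) auto
  then show False
    using open_not_negligible[OF op] assms(2) by (auto simp: negligible_iff_null_sets)
qed

theorem lemma9:
  fixes B \<Omega> :: "(real ^ 2) set" and \<mu> \<delta> :: real
  assumes "bounded B" and "simply_connected B" and "lipschitz_domain B" and "0 \<in> B"
    and "\<Omega> = UNIV - closure B"
    and "\<mu> \<noteq> 0"
    and "\<delta> > 0"
  shows "\<exists>v \<in> H1_0_sigma \<Omega>. \<exists>G. has_H1_gradient \<Omega> v G \<and>
           \<not> (AE x in lebesgue. x \<in> \<Omega> \<longrightarrow> v x = 0) \<and>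
           L2_inner \<Omega> (convection v G) (circular_flow \<mu>) \<ge> \<delta> * (L2_norm \<Omega> G)\<^sup>2"
proof -

  \<comment> \<open>Choice of the parameters\<close>
  obtain h h1 h2 M where h: "elem_smooth h" "elem_smooth h1"
    and dh [derivative_intros]: "\<And>t. (h has_real_derivative h1 t) (at t)"
      "\<And>t. (h1 has_real_derivative h2 t) (at t)"
    and hout: "\<And>t. t \<notin> {1..4} \<Longrightarrow> h t = 0" and hin: "\<And>t. t \<in> {2..3} \<Longrightarrow> exp (- 2) \<le> h t"
    and M: "\<And>t. \<bar>h t\<bar> \<le> M" "\<And>t. \<bar>h1 t\<bar> \<le> M" "\<And>t. \<bar>h2 t\<bar> \<le> M" "0 < M"
    using bump_exists by metis
  obtain r where r: "\<And>x. x \<in> closure B \<Longrightarrow> norm x \<le> r"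
    using bounded_closure[OF assms(1)] bounded_iff by metis
  \<comment> \<open>A lower bound for h^2 on [2, 3].\<close>
  define c :: real where "c = (exp (- 2))\<^sup>2"
  have c: "c > 0" by (simp add: c_def)
  \<comment> \<open>Once a factor k J is taken out, the final comparison reads k A \<le> C: the
    gradient bound and the convective error make up \<open>A\<close>, the main convective term gives
    \<open>C\<close>.\<close>
  define A where "A = \<delta> * 147456 * M\<^sup>2 + \<bar>\<mu>\<bar> / pi * (8 * M\<^sup>2)"
  define C where "C = \<bar>\<mu>\<bar> / pi * c"
  have A: "A \<ge> 0" using assms(7) by (simp add: A_def)
  have C: "C > 0" using assms(6) c by (simp add: C_def)
  \<comment> \<open>The summands of \<open>T\<close> serve in turn k \<le> 1, the clearance r^2 < 1
    + 1/k from the obstacle, and k A \<le> C.\<close>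
  define T where "T = 1 + r\<^sup>2 + A / C"
  have T: "1 \<le> T" "r\<^sup>2 < 1 + T" "A / C \<le> T"
    unfolding T_def using divide_nonneg_pos[OF A C] zero_le_power2[of r] by linarith+
  define k where "k = 1 / T"
  have k: "0 < k" "k \<le> 1" "r\<^sup>2 < 1 + 1 / k" "k * A \<le> C"
    using T C by (auto simp: k_def divide_le_eq mult.commute)
  \<comment> \<open>The sign of \<mu> fixes the sense of rotation, so that the main term carries
    |\<mu>|.\<close>
  define sg where "sg = sgn \<mu>"
  have sg: "\<bar>sg\<bar> = 1" "\<mu> * sg = \<bar>\<mu>\<bar>"
    using assms(6) by (auto simp: sg_def sgn_if)

  \<comment> \<open>The rotating profiles and their field\<close>
  define al where "al t = h t * cos t" for t
  define al1 where "al1 t = h1 t * cos t - h t * sin t" for t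
  define al2 where "al2 t = h2 t * cos t - 2 * h1 t * sin t - h t * cos t" for t
  define be where "be t = sg * (h t * sin t)" for t
  define be1 where "be1 t = sg * (h1 t * sin t + h t * cos t)" for t
  define be2 where "be2 t = sg * (h2 t * sin t + 2 * h1 t * cos t - h t * sin t)" for t
  have d: "(al has_real_derivative al1 t) (at t)" "(al1 has_real_derivative al2 t) (at t)"
    "(be has_real_derivative be1 t) (at t)" "(be1 has_real_derivative be2 t) (at t)" for t
    unfolding al_def[abs_def] al1_def[abs_def] al2_def be_def[abs_def] be1_def[abs_def] be2_def
    by (auto intro!: derivative_eq_intros simp: algebra_simps)
  have sc: "elem_smooth sin" "elem_smooth cos"
    using elem_smooth.sin[of 1 0] elem_smooth.sin[of 1 "pi / 2"] by (simp_all add: sin_add)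
  have sm: "elem_smooth al" "elem_smooth be" "elem_smooth al1" "elem_smooth be1"
    unfolding al_def[abs_def] be_def[abs_def] al1_def[abs_def] be1_def[abs_def]
    by (rule elem_smooth.mult[OF h(1) sc(2)]
        elem_smooth_cmult[OF elem_smooth.mult[OF h(1) sc(1)]]
        elem_smooth_diff[OF elem_smooth.mult[OF h(2) sc(2)] elem_smooth.mult[OF h(1) sc(1)]]
        elem_smooth_cmult[OF elem_smooth.add[OF elem_smooth.mult[OF h(2) sc(1)]
            elem_smooth.mult[OF h(1) sc(2)]]])+
  have sm_k: "elem_smooth (\<lambda>t. f (k * t))" if "elem_smooth f" for f
    using elem_smooth_affine[OF that, of k 0] by simp
  \<comment> \<open>Each differentiation brings out a factor \<open>k\<close>. Since
    \<open>h\<close> lives on [1, 4], the support in \<open>tau\<close> is [1/k, 4/k].\<close>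
  interpret S: swirl "\<lambda>t. al (k * t)" "\<lambda>t. be (k * t)" "\<lambda>t. k * al1 (k * t)" "\<lambda>t. k * be1 (k * t)"
    "\<lambda>t. k * (k * al2 (k * t))" "\<lambda>t. k * (k * be2 (k * t))" "1 / k" "4 / k"
  proof
    show "elem_smooth (\<lambda>t. al (k * t))" "elem_smooth (\<lambda>t. be (k * t))"
      "elem_smooth (\<lambda>t. k * al1 (k * t))" "elem_smooth (\<lambda>t. k * be1 (k * t))"
      by (intro sm_k elem_smooth_cmult sm)+
    show "((\<lambda>t. al (k * t)) has_real_derivative k * al1 (k * t)) (at t)"
      "((\<lambda>t. be (k * t)) has_real_derivative k * be1 (k * t)) (at t)" for t
      using has_real_derivative_scale[OF d(1), of 1] has_real_derivative_scale[OF d(3), of 1] by simp_all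
    show "((\<lambda>t. k * al1 (k * t)) has_real_derivative k * (k * al2 (k * t))) (at t)"
      "((\<lambda>t. k * be1 (k * t)) has_real_derivative k * (k * be2 (k * t))) (at t)" for t
      by (rule has_real_derivative_scale d)+
    have "k * t \<notin> {1..4}" if "t \<notin> {1 / k..4 / k}" for t
      using that k(1) by (auto simp: field_simps)
    then show "al (k * t) = 0" "be (k * t) = 0" if "t \<notin> {1 / k..4 / k}" for t
      using that hout by (auto simp: al_def be_def)
    show "1 \<le> 1 / k" using k by simp
  qed
  have Kin: "S.K \<subseteq> \<Omega>"
  proof
    fix x assume "x \<in> S.K"
    then have "exp (1 / k) \<le> (norm x)\<^sup>2"
      by (simp add: S.K_def power2_norm_eq_inner)
    \<comment> \<open>exp(1/k) \<ge> 1 + 1/k > r^2 places the annulus beyond the closed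
      obstacle.\<close>
    with k(3) exp_ge_add_one_self[of "1 / k"] have "r\<^sup>2 < (norm x)\<^sup>2" by linarith
    then have "\<not> norm x \<le> r"
      using power_mono[of "norm x" r 2] by auto
    then show "x \<in> \<Omega>" using r assms(5) by auto
  qed

  \<comment> \<open>Rings of equal weight\<close>
  define ring where "ring j = ring_weight (exp (j / k)) (exp ((j + 1) / k))" for j :: real
  define J where "J = integral\<^sup>L lborel (ring 1)"
  have ring_step: "integral\<^sup>L lborel (ring (j + 1)) = integral\<^sup>L lborel (ring j)" for j
  proof -
    \<comment> \<open>Dilation by exp(1/(2k)) multiplies squared radii by exp(1/k) and so carries
      each ring to the next.\<close>
    have "(exp (1 / (2 * k)))\<^sup>2 = exp (1 / k)"
      by (simp add: power2_eq_square exp_add[symmetric])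
    then show ?thesis
      using integral_ring_weight_dilation[of "exp (1 / (2 * k))" "exp (j / k)" "exp ((j + 1) / k)"]
      by (simp add: ring_def exp_add[symmetric] add_divide_distrib add_ac)
  qed
  have ring_int: "integral\<^sup>L lborel (ring 2) = J" "integral\<^sup>L lborel (ring 3) = J" "integral\<^sup>L lborel (ring 4) = J"
    using ring_step[of 1] ring_step[of 2] ring_step[of 3] by (simp_all add: J_def)
  have ring_integrable: "integrable lborel (ring j)" for j
    unfolding ring_def by (rule integrable_ring_weight) simp
  have J: "J \<ge> 0"
    unfolding J_def ring_def by (rule Bochner_Integration.integral_nonneg) (rule ring_weight_nonneg)
  have ring_eq: "ring j x = (if j \<le> k * S.tau x \<and> k * S.tau x < j + 1 then inverse (x \<bullet> x) else 0)"
    if "x \<noteq> 0" for j x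
  proof -
    have e: "exp (S.tau x) = x \<bullet> x" using that by simp
    have "exp (j / k) \<le> exp (S.tau x) \<longleftrightarrow> j \<le> k * S.tau x"
        "exp (S.tau x) < exp ((j + 1) / k) \<longleftrightarrow> k * S.tau x < j + 1"
      unfolding exp_le_cancel_iff exp_less_cancel_iff using k(1)
      by (simp_all only: pos_divide_le_eq pos_less_divide_eq mult.commute[of k])
    note this[unfolded e]
    then show ?thesis
      unfolding ring_def ring_weight_def by simp
  qed
  have ring_0: "ring j 0 = 0" for j
    by (simp add: ring_def ring_weight_def)
  \<comment> \<open>The rings cover 1 \<le> k tau < 5; the fourth is there because the endpoint 4 of
    the support is missing from the half-open third.\<close>
  let ?R = "\<lambda>x. ring 1 x + ring 2 x + ring 3 x + ring 4 x"
  have R_int: "integrable lborel ?R" "integral\<^sup>L lborel ?R = 4 * J"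
    using ring_integrable ring_int by (auto simp: J_def)

  \<comment> \<open>Lower bound for the convective integral\<close>
  have lower: "2 * \<bar>\<mu>\<bar> / pi * (k * c * ring 2 x - 2 * k\<^sup>2 * M\<^sup>2 * ?R x)
      \<le> S.convection_density \<mu> x + S.convection_density \<mu> (rot90 x)" for x
  proof (cases "x = 0")
    case True
    then show ?thesis by (simp add: ring_0 S.convection_density_rot90)
  next
    case False
    define u where "u = k * S.tau x"
    define q where "q = inverse (x \<bullet> x)"
    have q: "q \<ge> 0" by (simp add: q_def)
    have "S.convection_density \<mu> x + S.convection_density \<mu> (rot90 x) =
        2 * \<mu> / pi * q * (k * (al u * be1 u - be u * al1 u) + k\<^sup>2 * (al u * be2 u - be u * al2 u))"
      unfolding S.convection_density_rot90 u_def q_def by (simp add: power2_eq_square algebra_simps)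
    \<comment> \<open>The Wronskian of h (cos, sg sin) is sg h^2, and its derivative is 2 sg h
      h'.\<close>
    also have "al u * be1 u - be u * al1 u = sg * (h u)\<^sup>2 * ((sin u)\<^sup>2 + (cos u)\<^sup>2)"
      unfolding al_def be_def al1_def be1_def by algebra
    also have "al u * be2 u - be u * al2 u = sg * (2 * h u * h1 u) * ((sin u)\<^sup>2 + (cos u)\<^sup>2)"
      unfolding al_def be_def al2_def be2_def by algebra
    also have "2 * \<mu> / pi * q * (k * (sg * (h u)\<^sup>2 * ((sin u)\<^sup>2 + (cos u)\<^sup>2)) +
        k\<^sup>2 * (sg * (2 * h u * h1 u) * ((sin u)\<^sup>2 + (cos u)\<^sup>2))) =
        2 * (\<mu> * sg) / pi * (q * (k * (h u)\<^sup>2 + 2 * k\<^sup>2 * (h u * h1 u)))"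
      by (simp add: algebra_simps)
    finally have eq: "S.convection_density \<mu> x + S.convection_density \<mu> (rot90 x) =
        2 * \<bar>\<mu>\<bar> / pi * (q * (k * (h u)\<^sup>2 + 2 * k\<^sup>2 * (h u * h1 u)))"
      by (simp add: sg)
    have hh: "- M\<^sup>2 \<le> h u * h1 u"
    proof -
      have "\<bar>h u * h1 u\<bar> \<le> M * M"
        unfolding abs_mult using M by (intro mult_mono) (auto intro: less_imp_le)
      then show ?thesis by (simp add: power2_eq_square)
    qed
    have hh': "- (2 * k\<^sup>2 * M\<^sup>2) \<le> 2 * k\<^sup>2 * (h u * h1 u)"
      unfolding mult_minus_right[symmetric] by (rule mult_left_mono[OF hh]) simp
    have R: "?R x = (if 1 \<le> u \<and> u < 5 then q else 0)" and R2: "ring 2 x = (if 2 \<le> u \<and> u < 3 then q else 0)"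
      using ring_eq[OF False] unfolding u_def[symmetric] q_def[symmetric] by auto
    have "k * c * ring 2 x - 2 * k\<^sup>2 * M\<^sup>2 * ?R x \<le> q * (k * (h u)\<^sup>2 + 2 * k\<^sup>2 * (h u * h1 u))"
    proof -
      \<comment> \<open>The main term is kept only on the second ring, where h^2 \<ge> c; the error
        is charged to all four rings, and outside them \<open>h\<close> vanishes.\<close>
      consider "2 \<le> u \<and> u < 3" | "1 \<le> u \<and> u < 5" "\<not> (2 \<le> u \<and> u < 3)" | "\<not> (1 \<le> u \<and> u < 5)"
        by linarith
      then show ?thesis
      proof cases
        case 1
        then have "c \<le> (h u)\<^sup>2"
          unfolding c_def using hin[of u] by (intro power_mono) auto
        then have "k * c \<le> k * (h u)\<^sup>2" using k by simp
        then have "k * c - 2 * k\<^sup>2 * M\<^sup>2 \<le> k * (h u)\<^sup>2 + 2 * k\<^sup>2 * (h u * h1 u)"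
          using hh' by linarith
        from mult_left_mono[OF this q] show ?thesis
          unfolding R unfolding R2 using 1 by (simp add: algebra_simps)
      next
        case 2
        have "0 \<le> k * (h u)\<^sup>2" using k by simp
        then have "- (2 * k\<^sup>2 * M\<^sup>2) \<le> k * (h u)\<^sup>2 + 2 * k\<^sup>2 * (h u * h1 u)"
          using hh' by linarith
        from mult_left_mono[OF this q] show ?thesis
          unfolding R unfolding R2 if_P[OF 2(1)] if_not_P[OF 2(2)] by (simp add: algebra_simps)
      next
        case 3
        then have "h u = 0" using hout[of u] by auto
        with 3 show ?thesis unfolding R unfolding R2 by auto
      qed
    qed
    then show ?thesis
      unfolding eq by (intro mult_left_mono) auto
  qed
  have "2 * \<bar>\<mu>\<bar> / pi * (k * c * J - 2 * k\<^sup>2 * M\<^sup>2 * (4 * J)) =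
      (LINT x|lborel. 2 * \<bar>\<mu>\<bar> / pi * (k * c * ring 2 x - 2 * k\<^sup>2 * M\<^sup>2 * ?R x))"
    using R_int ring_integrable[of 2] ring_int(1) by simp
  also have "\<dots> \<le> 2 * integral\<^sup>L lborel (S.convection_density \<mu>)"
    unfolding S.two_integral_density
    by (intro integral_mono S.two_integral_density lower)
       (use R_int ring_integrable[of 2] in simp)
  also have "2 * \<bar>\<mu>\<bar> / pi * (k * c * J - 2 * k\<^sup>2 * M\<^sup>2 * (4 * J)) =
      2 * (\<bar>\<mu>\<bar> / pi * (k * c - 8 * k\<^sup>2 * M\<^sup>2) * J)"
    by (simp add: field_simps)
  finally have num: "\<bar>\<mu>\<bar> / pi * (k * c - 8 * k\<^sup>2 * M\<^sup>2) * J \<le> integral\<^sup>L lborel (S.convection_density \<mu>)"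
    by linarith

  \<comment> \<open>Upper bound for the Dirichlet integral\<close>
  have upper: "(norm (grad S.v x))\<^sup>2 \<le> 36864 * k\<^sup>2 * M\<^sup>2 * ?R x" for x
  proof (cases "x \<in> S.K")
    case False
    then show ?thesis
      unfolding S.norm_grad_v by (simp add: S.dv_outside ring_def ring_weight_nonneg)
  next
    case True
    then have x0: "x \<noteq> 0" by (auto simp: S.K_def)
    define u where "u = k * S.tau x"
    have u: "1 \<le> u" "u \<le> 4"
      using True S.tau_K[OF x0] k(1) by (auto simp: u_def field_simps)
    have R: "?R x = inverse (x \<bullet> x)"
      using u ring_eq[OF x0] unfolding u_def[symmetric] by auto
    have t: "\<bar>y * z\<bar> \<le> M" if "\<bar>y\<bar> \<le> M" "\<bar>z\<bar> \<le> 1" for y z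
      using mult_mono[OF that] M(4) by (simp add: abs_mult)
    note tt = t[OF M(1) abs_sin_le_one, of u u] t[OF M(1) abs_cos_le_one, of u u]
      t[OF M(2) abs_sin_le_one, of u u] t[OF M(2) abs_cos_le_one, of u u]
      t[OF M(3) abs_sin_le_one, of u u] t[OF M(3) abs_cos_le_one, of u u]
    \<comment> \<open>Counted with coefficients, the second derivatives have 1 + 2 + 1 = 4 terms of
      size at most \<open>M\<close>, the first derivatives fewer.\<close>
    have "\<bar>al1 u\<bar> \<le> 4 * M" "\<bar>al2 u\<bar> \<le> 4 * M"
      using tt unfolding al1_def al2_def by linarith+
    moreover have "\<bar>be1 u\<bar> \<le> 4 * M" "\<bar>be2 u\<bar> \<le> 4 * M"
      using tt unfolding be1_def be2_def abs_mult[of sg] sg mult_1_left by linarith+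
    \<comment> \<open>Since k \<le> 1, the factor k^2 of the second derivatives is at most
      \<open>k\<close>, so the single bound m = 4 k M of \<open>dv_bound\<close> fits both
      orders.\<close>
    moreover have "\<bar>k * y\<bar> \<le> k * (4 * M)" "\<bar>k * (k * y)\<bar> \<le> k * (4 * M)" if "\<bar>y\<bar> \<le> 4 * M" for y
    proof -
      show 1: "\<bar>k * y\<bar> \<le> k * (4 * M)" using that k(1) by (simp add: abs_mult)
      have "\<bar>k * y\<bar> \<le> 1 * (4 * M)" unfolding abs_mult using that k by (intro mult_mono) auto
      then show "\<bar>k * (k * y)\<bar> \<le> k * (4 * M)" using k(1) by (simp add: abs_mult)
    qed
    ultimately have "(S.dv j i x)\<^sup>2 \<le> 576 * (k * (4 * M))\<^sup>2 * inverse (x \<bullet> x)" for i j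
      by (intro S.dv_bound x0) (simp_all add: u_def)
    \<comment> \<open>Four matrix entries give 4 * 576 * 4^2 = 36864; integration over four rings
      gives 147456.\<close>
    then have "(norm (grad S.v x))\<^sup>2 \<le> 4 * (576 * (k * (4 * M))\<^sup>2 * inverse (x \<bullet> x))"
      unfolding S.norm_grad_v by (smt (verit))
    then show ?thesis unfolding R by (simp add: power_mult_distrib)
  qed
  have "(LINT x|lborel. (norm (grad S.v x))\<^sup>2) \<le> (LINT x|lborel. 36864 * k\<^sup>2 * M\<^sup>2 * ?R x)"
    by (intro integral_mono S.integrable_grad_v upper) (use R_int in simp)
  also have "\<dots> = 147456 * k\<^sup>2 * M\<^sup>2 * J"
    using R_int by simp
  finally have den: "(L2_norm \<Omega> (grad S.v))\<^sup>2 \<le> 147456 * k\<^sup>2 * M\<^sup>2 * J"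
    unfolding S.L2_norm_grad_v[OF Kin] .

  \<comment> \<open>Comparison of the two bounds\<close>
  have "\<delta> * (L2_norm \<Omega> (grad S.v))\<^sup>2 \<le> \<delta> * (147456 * k\<^sup>2 * M\<^sup>2 * J)"
    using den assms(7) by simp
  also have "\<dots> \<le> \<bar>\<mu>\<bar> / pi * (k * c - 8 * k\<^sup>2 * M\<^sup>2) * J"
  proof -
    \<comment> \<open>The choice k A \<le> C is multiplied by the nonnegative number k J.\<close>
    have "(k * A) * (k * J) \<le> C * (k * J)"
      using k J by (intro mult_right_mono) auto
    then show ?thesis
      by (simp add: A_def C_def power2_eq_square algebra_simps)
  qed
  also note num
  also have "integral\<^sup>L lborel (S.convection_density \<mu>) = L2_inner \<Omega> (convection S.v (grad S.v)) (circular_flow \<mu>)"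
    by (rule S.L2_inner_v[OF Kin, symmetric])
  finally have main: "\<delta> * (L2_norm \<Omega> (grad S.v))\<^sup>2 \<le>
      L2_inner \<Omega> (convection S.v (grad S.v)) (circular_flow \<mu>)" .

  \<comment> \<open>The field is not zero\<close>
  have "S.v (vector [exp (1 / k), 0]) $ 1 = be 2"
  proof -
    \<comment> \<open>The point lies on the first axis, where the \<open>w\<close> term drops out of
      the first component, and satisfies k tau = 2, where \<open>h\<close> and the sine are
      positive.\<close>
    have "vector [exp (1 / k), 0] \<bullet> (vector [exp (1 / k), 0] :: real ^ 2) = exp (2 / k)"
      by (simp add: inner_vec2 vector_2 exp_add[symmetric])
    then show ?thesis using k(1) by (simp add: S.v_def vector_2)
  qed
  moreover have "be 2 \<noteq> 0"
  proof -
    have "0 < h 2" by (rule less_le_trans[OF exp_gt_zero hin]) simp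
    moreover have "0 < sin (2::real)" using pi_gt3 by (intro sin_gt_zero) auto
    ultimately show ?thesis using sg(1) by (auto simp: be_def)
  qed
  ultimately have nz: "S.v (vector [exp (1 / k), 0]) \<noteq> 0"
    by (metis zero_index)
  have "\<not> (AE x in lebesgue. x \<in> \<Omega> \<longrightarrow> S.v x = 0)"
    by (rule not_AE_zero[where v = S.v, OF _ nz]) (use S.C_k_v[of 0] S.v_outside Kin in auto)
  moreover have "S.v \<in> H1_0_sigma \<Omega>"
    by (rule solenoidal_test_field_in_H1_0_sigma[OF S.v_test_field[OF Kin] S.gradient_v[OF Kin]])
  ultimately show ?thesis
    using main S.gradient_v[OF Kin] by blast
qed

end
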